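(* Let $(X_t)_{t\ge0}$ be a Lévy process in $\mathbb{R}^d$ with Lévy triplet $(b,0,\nu)$, and assume that its characteristic exponent $\psi$ satisfies the sector condition, i.e. $|\operatorname{Im}\psi(\xi)|\le C\operatorname{Re}\psi(\xi)$ for all $\xi\in\mathbb{R}^d$ and some constant $C>0$. Let $$\beta:=\inf\left\{\alpha>0:\int_{|y|<1}|y|^\alpha\,\nu(dy)<\infty\right\}\in[0,2].$$ (a) For every $\kappa\in(\tfrac12,\infty)$: $$\limsup_{t\to0}\frac{1}{t^\kappa}|X_t|=0\ \text{ a.s.}\iff\int_{|y|<1}|y|^{1/\kappa}\,\nu(dy)<\infty,$$ $$\limsup_{t\to0}\frac{1}{t^\kappa}|X_t|=\infty\ \text{ a.s.}\iff\int_{|y|<1}|y|^{1/\kappa}\,\nu(dy)=\infty.$$ (b) For every $\kappa>0$: if $\kappa<1/\beta$, then $\limsup_{t\to0}t^{-\kappa}|X_t|=0$ a.s.; if $\kappa>1/\beta$, then $\limsup_{t\to0}t^{-\kappa}|X_t|=\infty$ a.s. (c) If $$\limsup_{r\to0}\frac{\int_{|y|\le r}|y|^2\,\nu(dy)}{r^2\,\nu(\{|y|>r\})}<\infty,$$ then $\limsup_{t\to0}\frac1{\sqrt t}|X_t|=0$ a.s.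
   Context: A Lévy process is a stochastic process with $X_0=0$, stationary and independent increments and càdlàg sample paths in $\mathbb{R}^d$. It has Lévy triplet $(b,Q,\nu)$ and characteristic exponent $\psi$ if $\mathbb{E}e^{i\xi\cdot X_t}=e^{-t\psi(\xi)}$ with $$\psi(\xi)=-ib\cdot\xi+\tfrac12\xi\cdot Q\xi+\int_{y\ne0}\left(1-e^{iy\cdot\xi}+iy\cdot\xi\,\mathbf 1_{(0,1)}(|y|)\right)\nu(dy),$$ where $b\in\mathbb{R}^d$, $Q$ is positive semi-definite, and $\nu$ is a measure on $\mathbb{R}^d\setminus\{0\}$ with $\int\min\{1,|y|^2\}\,\nu(dy)<\infty$. Here $Q=0$. $\beta$ is the Blumenthal–Getoor index; $1/\beta:=\infty$ if $\beta=0$. Ratios are taken in $[0,\infty]$ with $a/0=\infty$ for $a>0$ and $0/0=0$. *)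

theory Defs
  imports "HOL-Probability.Probability"
begin

text \<open>
  \<open>\<real>\<^sup>d\<close> is an arbitrary type of class \<^class>\<open>euclidean_space\<close>. The time set \<open>[0, \<infinity>)\<close> is rendered by
  indexing processes with \<^typ>\<open>real\<close> and constraining them at nonnegative times only.
\<close>

definition cadlag :: "(real \<Rightarrow> 'a::topological_space) \<Rightarrow> bool" where
  "cadlag f \<longleftrightarrow>
     (\<forall>t\<ge>0. (f \<longlongrightarrow> f t) (at_right t)) \<and>
     (\<forall>t>0. \<exists>l. (f \<longlongrightarrow> l) (at_left t))"

locale levy_process = prob_space M
  for M :: "'w measure" and X :: "real \<Rightarrow> 'w \<Rightarrow> 'a::euclidean_space" +
  assumes measurable_process: "\<And>t. 0 \<le> t \<Longrightarrow> random_variable borel (X t)"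
    and start_zero: "\<And>\<omega>. \<omega> \<in> space M \<Longrightarrow> X 0 \<omega> = 0"
    and stationary_increments:
      "\<And>s t. 0 \<le> s \<Longrightarrow> 0 \<le> t \<Longrightarrow>
         distr M borel (\<lambda>\<omega>. X (s + t) \<omega> - X s \<omega>) = distr M borel (\<lambda>\<omega>. X t \<omega> - X 0 \<omega>)"
    and independent_increments:
      "\<And>(\<tau> :: nat \<Rightarrow> real) n. 0 \<le> \<tau> 0 \<Longrightarrow> mono_on {..n} \<tau> \<Longrightarrow>
         indep_vars (\<lambda>_. borel) (\<lambda>j \<omega>. X (\<tau> (Suc j)) \<omega> - X (\<tau> j) \<omega>) {..<n}"
    and cadlag_paths: "\<And>\<omega>. \<omega> \<in> space M \<Longrightarrow> cadlag (\<lambda>t. X t \<omega>)"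

text \<open>
  A measure on \<open>\<real>\<^sup>d - {0}\<close> is encoded as a Borel measure on the whole space without mass at the
  origin, so integrals over \<open>y \<noteq> 0\<close> are integrals over the whole space.
\<close>

definition levy_measure :: "'a::euclidean_space measure \<Rightarrow> bool" where
  "levy_measure \<nu> \<longleftrightarrow>
     sets \<nu> = sets borel \<and> emeasure \<nu> {0} = 0 \<and>
     (\<integral>\<^sup>+y. ennreal (min 1 ((norm y)\<^sup>2)) \<partial>\<nu>) < \<infinity>"

text \<open>The matrix \<open>Q\<close> is given by its linear map; positive semi-definite includes symmetric.\<close>

definition psd_map :: "('a::euclidean_space \<Rightarrow> 'a) \<Rightarrow> bool" where
  "psd_map Q \<longleftrightarrow> linear Q \<and> (\<forall>x y. Q x \<bullet> y = x \<bullet> Q y) \<and> (\<forall>x. 0 \<le> x \<bullet> Q x)"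

definition levy_exponent ::
    "'a::euclidean_space \<Rightarrow> ('a \<Rightarrow> 'a) \<Rightarrow> 'a measure \<Rightarrow> 'a \<Rightarrow> complex" where
  "levy_exponent b Q \<nu> \<xi> =
     - \<i> * complex_of_real (b \<bullet> \<xi>) + complex_of_real (\<xi> \<bullet> Q \<xi>) / 2 +
     (\<integral>y. 1 - exp (\<i> * complex_of_real (y \<bullet> \<xi>))
           + \<i> * complex_of_real ((y \<bullet> \<xi>) * indicator {0<..<1} (norm y)) \<partial>\<nu>)"

definition has_levy_triplet ::
    "'w measure \<Rightarrow> (real \<Rightarrow> 'w \<Rightarrow> 'a::euclidean_space) \<Rightarrow> 'a \<Rightarrow> ('a \<Rightarrow> 'a) \<Rightarrow> 'a measure \<Rightarrow> bool" where
  "has_levy_triplet M X b Q \<nu> \<longleftrightarrow>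
     psd_map Q \<and> levy_measure \<nu> \<and>
     (\<forall>t\<ge>0. \<forall>\<xi>. (\<integral>\<omega>. exp (\<i> * complex_of_real (\<xi> \<bullet> X t \<omega>)) \<partial>M) =
        exp (- complex_of_real t * levy_exponent b Q \<nu> \<xi>))"

definition sector_condition :: "('a \<Rightarrow> complex) \<Rightarrow> bool" where
  "sector_condition \<psi> \<longleftrightarrow> (\<exists>C>0. \<forall>\<xi>. \<bar>Im (\<psi> \<xi>)\<bar> \<le> C * Re (\<psi> \<xi>))"

definition small_jump_moment :: "'a::euclidean_space measure \<Rightarrow> real \<Rightarrow> ennreal" where
  "small_jump_moment \<nu> \<alpha> = (\<integral>\<^sup>+y\<in>{y. norm y < 1}. ennreal (norm y powr \<alpha>) \<partial>\<nu>)"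

definition blumenthal_getoor_index :: "'a::euclidean_space measure \<Rightarrow> real" where
  "blumenthal_getoor_index \<nu> = Inf {\<alpha>. 0 < \<alpha> \<and> small_jump_moment \<nu> \<alpha> < \<infinity>}"

text \<open>For a Levy measure the infimum is over a nonempty set, so it is not a junk value.\<close>

lemma small_jump_moment_2:
  assumes "levy_measure \<nu>"
  shows "small_jump_moment \<nu> 2 < \<infinity>"
proof -
  have "small_jump_moment \<nu> 2 \<le> (\<integral>\<^sup>+y. ennreal (min 1 ((norm y)\<^sup>2)) \<partial>\<nu>)"
    unfolding small_jump_moment_def
  proof (rule nn_integral_mono)
    fix y :: 'a
    show "ennreal (norm y powr 2) * indicator {y. norm y < 1} y \<le> ennreal (min 1 ((norm y)\<^sup>2))"
      by (cases "y = 0") (auto simp: indicator_def power_le_one)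
  qed
  then show ?thesis
    using assms by (auto simp: levy_measure_def intro: le_less_trans)
qed

lemma blumenthal_getoor_index_bounds:
  assumes "levy_measure \<nu>"
  shows "blumenthal_getoor_index \<nu> \<in> {0..2}"
proof -
  let ?A = "{\<alpha>. 0 < \<alpha> \<and> small_jump_moment \<nu> \<alpha> < \<infinity>}"
  have 2: "2 \<in> ?A"
    using small_jump_moment_2[OF assms] by simp
  have "Inf ?A \<le> 2"
    by (rule cInf_lower[OF 2]) (auto intro!: bdd_belowI[of _ 0])
  moreover have "0 \<le> Inf ?A"
  proof (rule cInf_greatest)
    show "?A \<noteq> {}"
      using 2 by blast
  qed auto
  ultimately show ?thesis
    by (simp add: blumenthal_getoor_index_def)
qed

definition limsup_ratio :: "(real \<Rightarrow> 'a::real_normed_vector) \<Rightarrow> real \<Rightarrow> ereal" where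
  "limsup_ratio x \<kappa> = Limsup (at_right 0) (\<lambda>t. ereal (norm (x t) / t powr \<kappa>))"

end

theory Submission
  imports Defs
begin

text \<open>
  Everything is reduced to the coordinates \<open>Y = X \<bullet> e\<close>, which are real Levy processes, and to the
  estimate \<open>E (1 - cos (\<theta> Y\<^sub>t)) \<le> (1 + C) t Re \<psi>(\<theta> e)\<close> given by the sector condition, where
  \<open>Re \<psi>(\<xi>) = \<integral> 1 - cos (y \<bullet> \<xi>) d\<nu>\<close>. No jump decomposition of the paths is used.

  Upper bounds: averaging over \<open>\<theta>\<close> turns the estimate into a tail bound for \<open>Y\<^sub>t\<close>, Ottaviani's
  inequality turns that into a maximal inequality, and Borel-Cantelli along \<open>t\<^sub>n = 2 powr (-n/\<kappa>)\<close>
  gives \<open>Y\<^sub>t = o(t powr \<kappa>)\<close> as soon as \<open>\<Sum>n. t\<^sub>n * \<integral> min 1 ((c 2^n |y|)\<^sup>2) d\<nu>\<close> is finite for all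
  \<open>c\<close>. By Fubini this sum is comparable to \<open>\<integral> min 1 (|y| powr (1/\<kappa>)) d\<nu>\<close> if \<open>\<kappa> > 1/2\<close>; under the
  condition in (c) it is dominated by the sum of the tails of \<open>\<nu>\<close>, hence finite for \<open>\<kappa> = 1/2\<close>.

  Lower bounds: let \<open>\<alpha> = 1/\<kappa>\<close>. The trigonometric kernel
  \<open>K(y) = (\<Sum>n<N. 2 powr (-\<alpha> n) * (1 - cos (2^n y))) - (A/m\<^sup>2) * (1 - cos (m y))\<close> is bounded by a
  multiple of \<open>min 1 (|y| powr \<alpha>)\<close> and, for suitable \<open>A\<close>, nonpositive near the origin. Its
  \<open>\<nu>\<close>-integral, the limit of \<open>E K(Y\<^sub>s) / s\<close> as \<open>s \<rightarrow> 0\<close>, is arbitrarily large: the sum diverges with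
  \<open>N\<close>, and the correction vanishes as \<open>m \<rightarrow> \<infinity>\<close> because there is no Gaussian part. Hence the sum over
  a grid of mesh \<open>s\<close> of the probabilities that the increment ending at \<open>u\<close> exceeds \<open>2 c u powr \<kappa>\<close> is
  arbitrarily large, and by independence some increment is that large almost surely.
\<close>

section \<open>Trigonometric and geometric estimates\<close>

lemma one_minus_cos_le: "1 - cos x \<le> x\<^sup>2 / 2" for x :: real
proof -
  have "1 - cos x = 2 * (sin (x/2))\<^sup>2"
    using cos_double_sin[of "x/2"] by simp
  also have "\<dots> \<le> 2 * (x/2)\<^sup>2"
    using abs_sin_x_le_abs_x[of "x/2"] by (intro mult_left_mono) (simp_all only: abs_le_square_iff)
  finally show ?thesis by (simp add: power2_eq_square)
qed

lemma one_minus_cos_le_min: "1 - cos x \<le> 2 * min 1 (x\<^sup>2)" for x :: real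
proof -
  have "1 - cos x \<le> 2 * 1" "1 - cos x \<le> 2 * x\<^sup>2"
    using one_minus_cos_le[of x] cos_ge_minus_one[of x] zero_le_power2[of x] by linarith+
  then show ?thesis unfolding min_def by presburger
qed

text \<open>By the mean value theorem \<open>sin y / y\<close> is a value of the cosine on
  \<open>[0, 1/2]\<close>, hence at least \<open>3/4\<close>, and the half-angle formula gives the
  claim with room to spare. The constant \<open>1/4\<close> determines \<open>A\<close> in
  \<open>cosine_kernel\<close> and the factor \<open>1/16\<close> in the divergence argument for the
  lower bound.\<close>

lemma one_minus_cos_ge:
  fixes x :: real
  assumes "\<bar>x\<bar> \<le> 1"
  shows "x\<^sup>2 / 4 \<le> 1 - cos x"
proof -
  define y where "y = \<bar>x\<bar> / 2"
  have y: "0 \<le> y" "y \<le> 1/2" using assms by (auto simp: y_def)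
  have "y * (3/4) \<le> sin y"
  proof (cases "y = 0")
    case False
    then obtain z where z: "0 < z" "z < y" "sin y - sin 0 = (y - 0) * cos z"
      using MVT2[of 0 y sin cos] y by (auto intro: DERIV_sin)
    have "z\<^sup>2 \<le> (1/2)\<^sup>2" using z y by (intro power_mono) auto
    then have "3/4 \<le> cos z" using one_minus_cos_le[of z] by (simp add: power2_eq_square)
    then show ?thesis using z y by (simp add: mult_left_mono)
  qed simp
  then have "(y * (3/4))\<^sup>2 \<le> (sin y)\<^sup>2" using y by (intro power_mono) auto
  moreover have "1 - cos x = 2 * (sin y)\<^sup>2"
    using cos_double_sin[of "y"] by (simp add: y_def)
  moreover have "x\<^sup>2 = 4 * y\<^sup>2" by (simp add: y_def power2_eq_square)
  moreover have "0 \<le> y * y" by simp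
  ultimately show ?thesis unfolding power_mult_distrib power2_eq_square by linarith
qed

text \<open>Let \<open>q = 2 powr -\<alpha>\<close>. The terms with \<open>2^n * z \<ge> 1\<close>
  form a geometric tail comparable to its first term because \<open>q < 1\<close>; the terms with
  \<open>2^n * z < 1\<close> grow by the factor \<open>4 * q > 1\<close> and are comparable to the
  last one. Both are of order \<open>z powr \<alpha>\<close>, and the condition
  \<open>0 < \<alpha> < 2\<close> says exactly \<open>q < 1 < 4 * q\<close>.\<close>

lemma sum_powers_min_square_le:
  fixes \<alpha> :: real
  assumes "0 < \<alpha>" "\<alpha> < 2"
  obtains C where "0 < C"
    "\<And>N z. 0 \<le> z \<Longrightarrow> (\<Sum>n<N. (2 powr -\<alpha>)^n * min 1 ((2^n * z)\<^sup>2)) \<le> C * min 1 (z powr \<alpha>)"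
proof -
  define q where "q = 2 powr -\<alpha>"
  have q: "0 < q" "q < 1" "1 < 4 * q"
    using assms powr_less_mono[of 0 \<alpha> 2] powr_less_mono[of \<alpha> 2 2]
    by (auto simp: q_def powr_minus field_simps)
  \<comment> \<open>\<open>A\<close> solves \<open>4 * q * A = A + 1\<close>, so one step of the
    recursion turns the correction into itself plus the new term. \<open>C\<close> exceeds the crude
    bound \<open>1 / (1 - q)\<close> by \<open>4 * A\<close>, the largest correction on the range
    \<open>z \<le> 2\<close>; doubling stays in this range because the recursion is used only for
    \<open>z < 1\<close>.\<close>
  define A where "A = 1 / (4 * q - 1)"
  define C where "C = 1 / (1 - q) + 4 * A"
  let ?F = "\<lambda>(N::nat) (z::real). \<Sum>n<N. q^n * min 1 ((2^n * z)\<^sup>2)"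
  have A: "0 < A" "A * (4 * q) = A + 1" using q by (auto simp: A_def field_simps)
  have triv: "?F N z \<le> 1 / (1 - q)" for N and z :: real
  proof -
    have "?F N z \<le> (\<Sum>n<N. q^n)" using q by (intro sum_mono) (auto intro: mult_left_le)
    also have "\<dots> \<le> (\<Sum>n. q^n)" using q by (intro sum_le_suminf summable_geometric) auto
    also have "\<dots> = 1 / (1 - q)" using q by (intro suminf_geometric) auto
    finally show ?thesis .
  qed
  text \<open>The correction \<open>- A * z\<^sup>2\<close> makes the bound stable under \<open>F (N+1) z = min 1 z\<^sup>2 + q * F N (2 z)\<close>.\<close>
  have main: "?F N z \<le> C * z powr \<alpha> - A * z\<^sup>2" if "0 \<le> z" "z \<le> 2" for N :: nat and z :: real
    using that
  proof (induction N arbitrary: z)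
    case 0
    show ?case
    proof (cases "z = 0")
      case False
      have "z\<^sup>2 \<le> 4 * z powr \<alpha>"
      proof -
        have "z\<^sup>2 = 4 * (z/2) powr 2" using 0 False by (simp add: powr_numeral power2_eq_square)
        also have "\<dots> \<le> 4 * (z/2) powr \<alpha>"
          using 0 False assms powr_mono'[of \<alpha> 2 "z/2"] by auto
        also have "\<dots> \<le> 4 * z powr \<alpha>" using 0 assms by (intro mult_left_mono powr_mono2) auto
        finally show ?thesis .
      qed
      then have "A * z\<^sup>2 \<le> A * (4 * z powr \<alpha>)" using A by simp
      also have "\<dots> \<le> C * z powr \<alpha>" using q by (simp add: C_def distrib_right)
      finally show ?thesis by simp
    qed simp
  next
    case (Suc N)
    show ?case
    proof (cases "1 \<le> z")
      case True
      have "?F (Suc N) z \<le> C - A * 4" using triv[of z "Suc N"] by (simp add: C_def)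
      also have "\<dots> \<le> C * z powr \<alpha> - A * z\<^sup>2"
      proof -
        have "1 \<le> z powr \<alpha>" using True assms by (intro ge_one_powr_ge_zero) auto
        moreover have "z\<^sup>2 \<le> 2\<^sup>2" using Suc True by (intro power_mono) auto
        moreover have "0 \<le> C" using A q by (simp add: C_def)
        ultimately show ?thesis
          using A mult_left_mono[of 1 "z powr \<alpha>" C] by (intro diff_mono) auto
      qed
      finally show ?thesis .
    next
      case False
      have "?F (Suc N) z = min 1 (z\<^sup>2) + q * ?F N (2 * z)"
        by (subst sum.lessThan_Suc_shift) (simp add: sum_distrib_left mult_ac)
      also have "\<dots> \<le> z\<^sup>2 + q * (C * (2 * z) powr \<alpha> - A * (2 * z)\<^sup>2)"
        using Suc.IH[of "2 * z"] Suc.prems False q by (intro add_mono mult_left_mono) auto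
      also have "\<dots> = z\<^sup>2 + C * z powr \<alpha> - (A * (4 * q)) * z\<^sup>2"
        using Suc.prems by (simp add: powr_mult q_def powr_minus field_simps)
      also have "\<dots> = C * z powr \<alpha> - A * z\<^sup>2"
        unfolding A by (simp add: algebra_simps)
      finally show ?thesis .
    qed
  qed
  have C: "0 < C" "1 / (1 - q) \<le> C" using A q by (auto simp: C_def intro: add_pos_pos)
  have "?F N z \<le> C * min 1 (z powr \<alpha>)" if "0 \<le> z" for N and z :: real
  proof (cases "z \<le> 1")
    case True
    have "z powr \<alpha> \<le> 1" using True that assms by (simp add: powr_le1)
    moreover have "0 \<le> A * z\<^sup>2" using A by simp
    ultimately show ?thesis using main[of z N] True that by (simp add: min_def)
  next
    case False
    then have "1 \<le> z powr \<alpha>" using assms by (intro ge_one_powr_ge_zero) auto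
    then show ?thesis using triv[of z N] C by (simp add: min_def)
  qed
  then show ?thesis using that C by (auto simp: q_def)
qed

section \<open>Tail and maximal inequalities\<close>

text \<open>Integrating over \<open>\<theta>\<close> in \<open>[0, u]\<close> gives
  \<open>u - sin (u * y) / y\<close>, which is at least \<open>u / 2\<close> as soon as
  \<open>\<bar>y\<bar> \<ge> 2 / u\<close>. After exchanging the two integrals of the nonnegative
  integrand, the average of the hypothesis bounds \<open>u / 2\<close> times the tail probability by
  \<open>u * B\<close>.\<close>

lemma (in prob_space) prob_ge_le_char:
  fixes Y :: "'a \<Rightarrow> real"
  assumes [measurable]: "random_variable borel Y" and "0 < u"
    and B: "\<And>\<theta>. 0 \<le> \<theta> \<Longrightarrow> \<theta> \<le> u \<Longrightarrow> expectation (\<lambda>\<omega>. 1 - cos (\<theta> * Y \<omega>)) \<le> B"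
  shows "prob {\<omega> \<in> space M. 2 / u \<le> \<bar>Y \<omega>\<bar>} \<le> 2 * B"
proof -
  interpret P: pair_sigma_finite lborel M ..
  have "0 \<le> expectation (\<lambda>\<omega>. 1 - cos (0 * Y \<omega>))" by simp
  then have B0: "0 \<le> B" using B[of 0] \<open>0 < u\<close> by simp
  have inner: "ennreal (u/2) * indicator {\<omega> \<in> space M. 2 / u \<le> \<bar>Y \<omega>\<bar>} \<omega>
      \<le> (\<integral>\<^sup>+\<theta>. ennreal (1 - cos (\<theta> * Y \<omega>)) * indicator {0..u} \<theta> \<partial>lborel)" for \<omega>
  proof (cases "\<omega> \<in> space M \<and> 2 / u \<le> \<bar>Y \<omega>\<bar>")
    case True
    define y where "y = Y \<omega>"
    have y: "y \<noteq> 0" "2 \<le> u * \<bar>y\<bar>" using True \<open>0 < u\<close> by (auto simp: y_def field_simps)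
    have "(\<integral>\<^sup>+\<theta>. ennreal (1 - cos (\<theta> * y)) * indicator {0..u} \<theta> \<partial>lborel)
        = ennreal ((u - sin (u * y) / y) - (0 - sin (0 * y) / y))"
      using y \<open>0 < u\<close>
      by (intro nn_integral_FTC_Icc) (auto intro!: derivative_eq_intros)
    moreover have "sin (u * y) / y \<le> u / 2"
    proof -
      have "sin (u * y) / y \<le> \<bar>sin (u * y) / y\<bar>" by (rule abs_ge_self)
      also have "\<dots> = \<bar>sin (u * y)\<bar> / \<bar>y\<bar>" by (rule abs_divide)
      also have "\<dots> \<le> 1 / \<bar>y\<bar>" using y by (intro divide_right_mono) auto
      also have "\<dots> \<le> u / 2" using y by (simp add: field_simps)
      finally show ?thesis .
    qed
    ultimately show ?thesis using True by (simp add: y_def ennreal_leI)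
  qed auto
  have "ennreal (u/2) * emeasure M {\<omega> \<in> space M. 2 / u \<le> \<bar>Y \<omega>\<bar>}
      = (\<integral>\<^sup>+\<omega>. ennreal (u/2) * indicator {\<omega> \<in> space M. 2 / u \<le> \<bar>Y \<omega>\<bar>} \<omega> \<partial>M)"
    by (subst nn_integral_cmult_indicator) auto
  also have "\<dots> \<le> (\<integral>\<^sup>+\<omega>. (\<integral>\<^sup>+\<theta>. ennreal (1 - cos (\<theta> * Y \<omega>)) * indicator {0..u} \<theta> \<partial>lborel) \<partial>M)"
    by (intro nn_integral_mono inner)
  also have "\<dots> = (\<integral>\<^sup>+\<theta>. (\<integral>\<^sup>+\<omega>. ennreal (1 - cos (\<theta> * Y \<omega>)) * indicator {0..u} \<theta> \<partial>M) \<partial>lborel)"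
    by (rule P.Fubini') measurable
  also have "\<dots> \<le> (\<integral>\<^sup>+\<theta>. ennreal B * indicator {0..u} \<theta> \<partial>lborel)"
  proof (intro nn_integral_mono)
    fix \<theta> :: real
    have "(\<integral>\<^sup>+\<omega>. ennreal (1 - cos (\<theta> * Y \<omega>)) \<partial>M) = ennreal (expectation (\<lambda>\<omega>. 1 - cos (\<theta> * Y \<omega>)))"
      by (intro nn_integral_eq_integral integrable_const_bound[of _ 2]) 
         (auto intro!: AE_I2 simp: abs_le_iff; smt (verit) cos_ge_minus_one cos_le_one)+
    then show "(\<integral>\<^sup>+\<omega>. ennreal (1 - cos (\<theta> * Y \<omega>)) * indicator {0..u} \<theta> \<partial>M)
        \<le> ennreal B * indicator {0..u} \<theta>"
      using B[of \<theta>] by (auto simp: indicator_def intro: ennreal_leI)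
  qed
  also have "\<dots> = ennreal (B * u)"
    using \<open>0 < u\<close> B0 by (simp add: nn_integral_cmult ennreal_mult)
  finally have "ennreal (u/2 * prob {\<omega> \<in> space M. 2 / u \<le> \<bar>Y \<omega>\<bar>}) \<le> ennreal (B * u)"
    using \<open>0 < u\<close> by (subst ennreal_mult) (auto simp: emeasure_eq_measure)
  then have "u/2 * prob {\<omega> \<in> space M. 2 / u \<le> \<bar>Y \<omega>\<bar>} \<le> B * u"
    using \<open>0 < u\<close> B0 by (subst (asm) ennreal_le_iff) auto
  then show ?thesis using \<open>0 < u\<close> by (simp add: field_simps)
qed

lemma dyadic_between:
  fixes a b :: real
  assumes "0 \<le> a" "a < b"
  obtains k n :: nat where "a < k / 2^n" "k / 2^n < b"
proof -
  obtain n where n: "(1/2)^n < b - a"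
    using real_arch_pow_inv[of "b - a" "1/2"] assms by auto
  define k where "k = nat \<lfloor>a * 2^n\<rfloor> + 1"
  have "real k = of_int \<lfloor>a * 2^n\<rfloor> + 1" using assms by (simp add: k_def)
  then have "a * 2^n < k" "k \<le> a * 2^n + 1" by linarith+
  moreover have "a * 2^n + 1 < b * 2^n" using n by (simp add: field_simps power_one_over)
  ultimately show ?thesis by (intro that[of k n]) (auto simp: field_simps)
qed

section \<open>Ottaviani's maximal inequality, first on finite grids and then on intervals\<close>

context levy_process
begin

lemma indep_vars_grid:
  assumes "0 \<le> s"
  shows "indep_vars (\<lambda>_. borel) (\<lambda>j \<omega>. X (real (Suc j) * s) \<omega> - X (real j * s) \<omega>) {..<m}"
  using assms by (intro independent_increments[of "\<lambda>j. real j * s"]) (auto intro!: mono_onI mult_right_mono)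

lemma measurable_grid [measurable]:
  assumes "0 \<le> s"
  shows "random_variable borel (X (real k * s))"
  using assms by (intro measurable_process) auto

lemma prob_increment:
  assumes "0 \<le> s" "0 \<le> t" "A \<in> sets borel"
  shows "prob {\<omega> \<in> space M. X (s + t) \<omega> - X s \<omega> \<in> A} = prob {\<omega> \<in> space M. X t \<omega> \<in> A}"
proof -
  have [measurable]: "random_variable borel (X (s + t))" "random_variable borel (X s)"
    "random_variable borel (X t)" "random_variable borel (X 0)" "A \<in> sets borel"
    using assms by (auto intro: measurable_process)
  have "prob {\<omega> \<in> space M. X (s + t) \<omega> - X s \<omega> \<in> A} = measure (distr M borel (\<lambda>\<omega>. X (s + t) \<omega> - X s \<omega>)) A"
    by (subst measure_distr) (auto intro!: arg_cong[where f=prob])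
  also have "\<dots> = measure (distr M borel (\<lambda>\<omega>. X t \<omega> - X 0 \<omega>)) A"
    using assms by (simp add: stationary_increments)
  also have "\<dots> = prob {\<omega> \<in> space M. X t \<omega> \<in> A}"
    by (subst measure_distr) (auto intro!: arg_cong[where f=prob] simp: start_zero)
  finally show ?thesis .
qed

lemma grid_telescope:
  assumes "\<omega> \<in> space M" "j \<le> k"
  shows "(\<Sum>i\<in>{j..<k}. X (real (Suc i) * s) \<omega> - X (real i * s) \<omega>) = X (real k * s) \<omega> - X (real j * s) \<omega>"
  using assms(2) by (rule sum_Suc_diff')

text \<open>\<open>F k\<close> says that \<open>k\<close> is the first grid index at which the level
  \<open>2 * r\<close> is exceeded, \<open>G k\<close> that the process moves by less than
  \<open>r\<close> from \<open>k\<close> to the end. They involve disjoint sets of increments, so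
  they are independent, and \<open>G k\<close> has probability at least \<open>1/2\<close> by
  stationarity and the hypothesis at \<open>m - k\<close>. On \<open>F k \<inter> G k\<close> the
  final value still has norm at least \<open>r\<close>; summing over the disjoint events costs only
  the factor \<open>2\<close>.\<close>

lemma ottaviani_grid:
  assumes "0 \<le> s" "0 < r" "p \<le> 1/2"
    and p: "\<And>k. k \<le> m \<Longrightarrow> prob {\<omega> \<in> space M. r \<le> norm (X (real k * s) \<omega>)} \<le> p"
  shows "prob {\<omega> \<in> space M. \<exists>k\<le>m. 2 * r < norm (X (real k * s) \<omega>)} \<le> 2 * p"
proof -
  note [measurable] = measurable_grid[OF \<open>0 \<le> s\<close>]
  let ?D = "\<lambda>j \<omega>. X (real (Suc j) * s) \<omega> - X (real j * s) \<omega>"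
  define F where "F k = {\<omega> \<in> space M. 2 * r < norm (X (real k * s) \<omega>) \<and> (\<forall>j<k. norm (X (real j * s) \<omega>) \<le> 2 * r)}" for k
  define G where "G k = {\<omega> \<in> space M. norm (X (real m * s) \<omega> - X (real k * s) \<omega>) < r}" for k
  have sets_F_G [measurable]: "F k \<in> events" "G k \<in> events" for k
    unfolding F_def G_def by measurable
  have indep: "prob (F k \<inter> G k) = prob (F k) * prob (G k)" if "k \<le> m" for k
  proof -
    let ?P = "\<lambda>I. Pi\<^sub>M I (\<lambda>_. borel :: 'a measure)"
    \<comment> \<open>\<open>F k\<close> and \<open>G k\<close> are rewritten as preimages of
      product-space sets under the increments before \<open>k\<close> and from \<open>k\<close> on.
      Partial sums of increments recover the values of the process because it starts at
      zero.\<close>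
    define A where "A = {f \<in> space (?P {..<k}). 2 * r < norm (\<Sum>i\<in>{0..<k}. f i) \<and> (\<forall>j<k. norm (\<Sum>i\<in>{0..<j}. f i) \<le> 2 * r)}"
    define B where "B = {f \<in> space (?P {k..<m}). norm (\<Sum>i\<in>{k..<m}. f i) < r}"
    have "A \<in> sets (?P {..<k})"
    proof -
      have [measurable]: "(\<lambda>f. \<Sum>i\<in>{0..<j}. f i) \<in> borel_measurable (?P {..<k})" if "j \<le> k" for j
        using that by (intro borel_measurable_sum measurable_component_singleton) auto
      have "A = {f \<in> space (?P {..<k}). 2 * r < norm (\<Sum>i\<in>{0..<k}. f i)} \<inter>
          {f \<in> space (?P {..<k}). \<forall>j\<in>{..<k}. norm (\<Sum>i\<in>{0..<j}. f i) \<le> 2 * r}"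
        by (auto simp: A_def)
      moreover have "{f \<in> space (?P {..<k}). \<forall>j\<in>{..<k}. norm (\<Sum>i\<in>{0..<j}. f i) \<le> 2 * r} \<in> sets (?P {..<k})"
        by (rule sets.sets_Collect_finite_All) (auto intro!: borel_measurable_le borel_measurable_norm borel_measurable_sum measurable_component_singleton)
      ultimately show ?thesis by simp
    qed
    moreover have "B \<in> sets (?P {k..<m})"
      unfolding B_def by (auto intro!: borel_measurable_less borel_measurable_norm borel_measurable_sum measurable_component_singleton)
    moreover have "indep_var (?P {..<k}) (\<lambda>\<omega>. restrict (\<lambda>i. ?D i \<omega>) {..<k}) (?P {k..<m}) (\<lambda>\<omega>. restrict (\<lambda>i. ?D i \<omega>) {k..<m})"
      using that by (intro indep_var_restrict[OF indep_vars_grid[OF \<open>0 \<le> s\<close>, of m]]) auto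
    ultimately have "prob ((\<lambda>\<omega>. (restrict (\<lambda>i. ?D i \<omega>) {..<k}, restrict (\<lambda>i. ?D i \<omega>) {k..<m})) -` (A \<times> B) \<inter> space M)
        = prob ((\<lambda>\<omega>. restrict (\<lambda>i. ?D i \<omega>) {..<k}) -` A \<inter> space M) * prob ((\<lambda>\<omega>. restrict (\<lambda>i. ?D i \<omega>) {k..<m}) -` B \<inter> space M)"
      by (intro indep_varD)
    moreover have FA: "(\<lambda>\<omega>. restrict (\<lambda>i. ?D i \<omega>) {..<k}) -` A \<inter> space M = F k"
    proof -
      have *: "(\<Sum>i\<in>{0..<j}. restrict (\<lambda>i. ?D i \<omega>) {..<k} i) = X (real j * s) \<omega>" if "\<omega> \<in> space M" "j \<le> k" for \<omega> j
      proof -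
        have "(\<Sum>i\<in>{0..<j}. restrict (\<lambda>i. ?D i \<omega>) {..<k} i) = (\<Sum>i\<in>{0..<j}. ?D i \<omega>)"
          using that by (intro sum.cong) auto
        then show ?thesis using grid_telescope[of \<omega> 0 j s] that start_zero[of \<omega>] by simp
      qed
      have "restrict (\<lambda>i. ?D i \<omega>) {..<k} \<in> A \<longleftrightarrow> \<omega> \<in> F k" if "\<omega> \<in> space M" for \<omega>
        using that * by (simp add: A_def F_def space_PiM del: restrict_apply)
      then show ?thesis
        using sets.sets_into_space[OF sets_F_G(1)[of k]] by (simp only: set_eq_iff vimage_eq Int_iff) blast
    qed
    moreover have GB: "(\<lambda>\<omega>. restrict (\<lambda>i. ?D i \<omega>) {k..<m}) -` B \<inter> space M = G k"
    proof -
      have "restrict (\<lambda>i. ?D i \<omega>) {k..<m} \<in> B \<longleftrightarrow> \<omega> \<in> G k" if "\<omega> \<in> space M" for \<omega>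
      proof -
        have "(\<Sum>i\<in>{k..<m}. restrict (\<lambda>i. ?D i \<omega>) {k..<m} i) = (\<Sum>i\<in>{k..<m}. ?D i \<omega>)"
          by (intro sum.cong) auto
        also have "\<dots> = X (real m * s) \<omega> - X (real k * s) \<omega>"
          using that \<open>k \<le> m\<close> by (rule grid_telescope)
        finally show ?thesis using that by (simp add: B_def G_def space_PiM del: restrict_apply)
      qed
      then show ?thesis
        using sets.sets_into_space[OF sets_F_G(2)[of k]] by (simp only: set_eq_iff vimage_eq Int_iff) blast
    qed
    moreover have "(\<lambda>\<omega>. (restrict (\<lambda>i. ?D i \<omega>) {..<k}, restrict (\<lambda>i. ?D i \<omega>) {k..<m})) -` (A \<times> B) \<inter> space M = F k \<inter> G k"
      unfolding FA[symmetric] GB[symmetric] by (simp only: set_eq_iff vimage_eq Int_iff mem_Times_iff fst_conv snd_conv) blast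
    ultimately show ?thesis by simp
  qed
  have G: "1/2 \<le> prob (G k)" if "k \<le> m" for k
  proof -
    have eq: "real k * s + real (m - k) * s = real m * s" using that by (simp add: of_nat_diff algebra_simps)
    have "prob {\<omega> \<in> space M. X (real k * s + real (m - k) * s) \<omega> - X (real k * s) \<omega> \<in> {x. r \<le> norm x}}
        = prob {\<omega> \<in> space M. X (real (m - k) * s) \<omega> \<in> {x. r \<le> norm x}}"
      using \<open>0 \<le> s\<close> by (intro prob_increment) auto
    also have "\<dots> \<le> 1/2" using p[of "m - k"] \<open>p \<le> 1/2\<close> by simp
    finally have "prob {\<omega> \<in> space M. r \<le> norm (X (real m * s) \<omega> - X (real k * s) \<omega>)} \<le> 1/2"
      unfolding eq by simp
    moreover have "G k = space M - {\<omega> \<in> space M. r \<le> norm (X (real m * s) \<omega> - X (real k * s) \<omega>)}"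
      by (auto simp: G_def)
    ultimately show ?thesis by (simp add: prob_compl)
  qed
  have disj: "disjoint_family_on (\<lambda>k. F k \<inter> G k) {..m}"
  proof (unfold disjoint_family_on_def, intro ballI impI)
    fix i j :: nat assume "i \<noteq> j"
    then consider "i < j" | "j < i" by linarith
    then show "F i \<inter> G i \<inter> (F j \<inter> G j) = {}"
      by cases (fastforce simp: F_def)+
  qed
  have "{\<omega> \<in> space M. \<exists>k\<le>m. 2 * r < norm (X (real k * s) \<omega>)} \<subseteq> (\<Union>k\<in>{..m}. F k)"
  proof
    fix \<omega> assume *: "\<omega> \<in> {\<omega> \<in> space M. \<exists>k\<le>m. 2 * r < norm (X (real k * s) \<omega>)}"
    define k where "k = (LEAST k. 2 * r < norm (X (real k * s) \<omega>))"
    from * obtain k' where k': "k' \<le> m" "2 * r < norm (X (real k' * s) \<omega>)" by auto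
    have "k \<le> k'" unfolding k_def using k'(2) by (rule Least_le)
    moreover have "2 * r < norm (X (real k * s) \<omega>)" unfolding k_def using k'(2) by (rule LeastI)
    moreover have "norm (X (real j * s) \<omega>) \<le> 2 * r" if "j < k" for j
      using not_less_Least[of j "\<lambda>k. 2 * r < norm (X (real k * s) \<omega>)"] that by (simp add: k_def)
    ultimately have "\<omega> \<in> F k" "k \<le> m" using * k' by (auto simp: F_def)
    then show "\<omega> \<in> (\<Union>k\<in>{..m}. F k)" by auto
  qed
  then have "prob {\<omega> \<in> space M. \<exists>k\<le>m. 2 * r < norm (X (real k * s) \<omega>)} \<le> prob (\<Union>k\<in>{..m}. F k)"
    by (intro finite_measure_mono) auto
  also have "\<dots> \<le> (\<Sum>k\<in>{..m}. prob (F k))"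
    by (intro finite_measure_subadditive_finite) auto
  also have "\<dots> \<le> (\<Sum>k\<in>{..m}. 2 * prob (F k \<inter> G k))"
  proof (intro sum_mono)
    fix k assume "k \<in> {..m}"
    then show "prob (F k) \<le> 2 * prob (F k \<inter> G k)"
      using mult_left_mono[OF G[of k] measure_nonneg[of M "F k"]] by (simp add: indep)
  qed
  also have "\<dots> = 2 * prob (\<Union>k\<in>{..m}. F k \<inter> G k)"
    using disj by (subst finite_measure_finite_Union) (auto simp: sum_distrib_left)
  also have "\<dots> \<le> 2 * prob {\<omega> \<in> space M. r \<le> norm (X (real m * s) \<omega>)}"
  proof -
    have "r \<le> norm (X (real m * s) \<omega>)" if "\<omega> \<in> F k \<inter> G k" for k \<omega>
    proof -
      have "norm (X (real k * s) \<omega>) \<le> norm (X (real m * s) \<omega>) + norm (X (real m * s) \<omega> - X (real k * s) \<omega>)"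
        by norm
      then show ?thesis using that by (auto simp: F_def G_def)
    qed
    then have "(\<Union>k\<in>{..m}. F k \<inter> G k) \<subseteq> {\<omega> \<in> space M. r \<le> norm (X (real m * s) \<omega>)}"
      by (auto simp: F_def)
    then show ?thesis by (auto intro!: finite_measure_mono)
  qed
  also have "\<dots> \<le> 2 * p" using p[of m] by simp
  finally show ?thesis .
qed

text \<open>The dyadic grids of \<open>[0, t]\<close> increase, so the grid bound passes to their
  union by continuity from below. By right-continuity an exceedance at \<open>s < t\<close> persists
  on some interval to the right of \<open>s\<close>, which contains a dyadic point. The conclusion
  is an enclosing event \<open>E\<close>, which avoids measurability of a statement over uncountably
  many times; for \<open>p > 1/2\<close> the whole space will do.\<close>

lemma ottaviani:
  assumes "0 \<le> t" "0 < r"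
    and p: "\<And>s. 0 \<le> s \<Longrightarrow> s \<le> t \<Longrightarrow> prob {\<omega> \<in> space M. r \<le> norm (X s \<omega>)} \<le> p"
  obtains E where "E \<in> events" "prob E \<le> 2 * p"
    "{\<omega> \<in> space M. \<exists>s\<in>{0..t}. 2 * r < norm (X s \<omega>)} \<subseteq> E"
proof (cases "p \<le> 1/2")
  case False
  then show thesis by (intro that[of "space M"]) (auto simp: prob_space)
next
  case True
  define E where "E n = {\<omega> \<in> space M. \<exists>k\<le>2^n. 2 * r < norm (X (real k * (t / 2^n)) \<omega>)}" for n :: nat
  have [measurable]: "E n \<in> events" for n
  proof -
    have [measurable]: "random_variable borel (X (real k * (t / 2^n)))" for k
      using \<open>0 \<le> t\<close> by (intro measurable_grid) auto
    have "E n = (\<Union>k\<in>{..2^n}. {\<omega> \<in> space M. 2 * r < norm (X (real k * (t / 2^n)) \<omega>)})"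
      by (auto simp: E_def)
    moreover have "{\<omega> \<in> space M. 2 * r < norm (X (real k * (t / 2^n)) \<omega>)} \<in> events" for k
      by measurable
    ultimately show ?thesis by (simp only: sets.finite_UN finite_atMost)
  qed
  have "prob (E n) \<le> 2 * p" for n
    unfolding E_def
  proof (rule ottaviani_grid)
    fix k :: nat assume "k \<le> 2^n"
    then have "real k \<le> 2^n" by (simp add: numeral_power_le_of_nat_cancel_iff flip: of_nat_le_iff)
    then have "real k * (t / 2^n) \<le> t" using \<open>0 \<le> t\<close> by (simp add: field_simps mult_left_mono)
    then show "prob {\<omega> \<in> space M. r \<le> norm (X (real k * (t / 2^n)) \<omega>)} \<le> p"
      using \<open>0 \<le> t\<close> by (intro p) auto
  qed (use assms True in auto)
  moreover have "incseq E"
  proof (rule incseq_SucI, rule subsetI)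
    fix n \<omega> assume "\<omega> \<in> E n"
    then obtain k where "\<omega> \<in> space M" "k \<le> 2^n" "2 * r < norm (X (real k * (t / 2^n)) \<omega>)"
      by (auto simp: E_def)
    then show "\<omega> \<in> E (Suc n)" by (auto simp: E_def intro!: exI[of _ "2 * k"])
  qed
  ultimately have "prob (\<Union>n. E n) \<le> 2 * p"
    by (intro LIMSEQ_le_const2[OF finite_Lim_measure_incseq]) auto
  moreover have "{\<omega> \<in> space M. \<exists>s\<in>{0..t}. 2 * r < norm (X s \<omega>)} \<subseteq> (\<Union>n. E n)"
  proof
    fix \<omega> assume "\<omega> \<in> {\<omega> \<in> space M. \<exists>s\<in>{0..t}. 2 * r < norm (X s \<omega>)}"
    then obtain s where s: "\<omega> \<in> space M" "0 \<le> s" "s \<le> t" "2 * r < norm (X s \<omega>)" by auto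
    show "\<omega> \<in> (\<Union>n. E n)"
    proof (cases "s = t")
      \<comment> \<open>The right endpoint is treated separately: right-continuity there would lead
        out of \<open>[0, t]\<close>, but \<open>t\<close> is itself a point of the coarsest
        grid.\<close>
      case True
      then have "\<omega> \<in> E 0" using s by (auto simp: E_def intro!: exI[of _ 1])
      then show ?thesis by auto
    next
      case False
      have "((\<lambda>u. norm (X u \<omega>)) \<longlongrightarrow> norm (X s \<omega>)) (at_right s)"
        using cadlag_paths[OF s(1)] s(2) by (auto simp: cadlag_def intro: tendsto_norm)
      then have "\<forall>\<^sub>F u in at_right s. 2 * r < norm (X u \<omega>)"
        using s(4) by (rule order_tendstoD)
      then obtain b where b: "s < b" "\<And>u. s < u \<Longrightarrow> u < b \<Longrightarrow> 2 * r < norm (X u \<omega>)"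
        by (auto simp: eventually_at_right_field)
      have t: "0 < t" using s False by auto
      then have "0 \<le> s / t" "s / t < min b t / t" using s False b by (auto simp: divide_strict_right_mono)
      then obtain k n :: nat where kn: "s / t < k / 2^n" "k / 2^n < min b t / t"
        by (rule dyadic_between)
      then have "s < real k * (t / 2^n)" "real k * (t / 2^n) < min b t" using t by (auto simp: field_simps)
      moreover from this have "real k < 2^n" using t by (simp add: field_simps)
      then have "k \<le> 2^n" by (simp add: of_nat_less_numeral_power_cancel_iff)
      ultimately have "\<omega> \<in> E n" using b s(1) by (auto simp: E_def)
      then show ?thesis by auto
    qed
  qed
  ultimately show thesis by (intro that[of "\<Union>n. E n"]) auto
qed

end

section \<open>Growth of Levy processes at the origin\<close>

lemma at_right_0_geometric:
  fixes q t :: real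
  assumes "0 < q" "q < 1" "0 < t" "t \<le> q^N"
  obtains n where "N \<le> n" "q^(Suc n) < t" "t \<le> q^n"
proof -
  have ex: "\<exists>m. q^m < t" using real_arch_pow_inv assms by blast
  define m where "m = (LEAST m. q^m < t)"
  have m: "q^m < t" unfolding m_def using ex by (rule LeastI_ex)
  have least: "t \<le> q^j" if "j < m" for j
    using not_less_Least[of j "\<lambda>m. q^m < t"] that by (simp add: m_def)
  have "N < m"
  proof (rule ccontr)
    assume "\<not> N < m"
    then have "q^N \<le> q^m" using assms by (intro power_decreasing) auto
    then show False using m assms by linarith
  qed
  then show thesis using m least[of "m - 1"] by (intro that[of "m - 1"]) auto
qed

text \<open>The times \<open>q^n\<close> with \<open>q = 2 powr -(1/\<kappa>)\<close> satisfy
  \<open>(q^n) powr \<kappa> = 1 / 2^n\<close>. Ottaviani's inequality doubles the threshold, so by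
  Borel-Cantelli the path is eventually bounded by \<open>4 / (c * 2^n)\<close> on
  \<open>[0, q^n]\<close>. For \<open>t\<close> between \<open>q^(Suc n)\<close> and
  \<open>q^n\<close> one more factor \<open>2\<close> is lost, which gives the ratio bound
  \<open>8 / c\<close>; here \<open>c\<close> is arbitrarily large.\<close>

lemma (in levy_process) tendsto_zero_at_right:
  fixes \<kappa> :: real and H :: "real \<Rightarrow> real"
  assumes "0 < \<kappa>"
    and prob_le: "\<And>c n s. 0 < c \<Longrightarrow> 0 \<le> s \<Longrightarrow> s \<le> (2 powr -(1/\<kappa>))^n \<Longrightarrow>
      prob {\<omega> \<in> space M. 2 / (c * 2^n) \<le> norm (X s \<omega>)} \<le> (2 powr -(1/\<kappa>))^n * H (c * 2^n)"
    and summable: "\<And>c. 0 < c \<Longrightarrow> summable (\<lambda>n. (2 powr -(1/\<kappa>))^n * H (c * 2^n))"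
  shows "AE \<omega> in M. ((\<lambda>t. norm (X t \<omega>) / t powr \<kappa>) \<longlongrightarrow> 0) (at_right 0)"
proof -
  define q where "q = 2 powr -(1/\<kappa>)"
  have q: "0 < q" "q < 1" using \<open>0 < \<kappa>\<close> powr_less_mono[of "-(1/\<kappa>)" 0 2] by (auto simp: q_def)
  have q_powr: "(q^n) powr \<kappa> = 1 / 2^n" for n
  proof -
    have "(q^n) powr \<kappa> = (q powr \<kappa>)^n"
      using q by (simp add: powr_realpow[symmetric] powr_powr mult.commute)
    also have "q powr \<kappa> = 1/2"
      unfolding q_def powr_powr using \<open>0 < \<kappa>\<close> by (simp add: powr_minus)
    finally show ?thesis by (simp add: power_one_over)
  qed
  have bound: "AE \<omega> in M. \<forall>\<^sub>F t in at_right 0. norm (X t \<omega>) / t powr \<kappa> \<le> 8 / c" if "0 < c" for c :: real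
  proof -
    have "\<exists>E. E \<in> events \<and> prob E \<le> 2 * (q^n * H (c * 2^n)) \<and>
        {\<omega> \<in> space M. \<exists>s\<in>{0..q^n}. 2 * (2 / (c * 2^n)) < norm (X s \<omega>)} \<subseteq> E" for n
      using that q
      by (rule_tac ottaviani[of "q^n" "2 / (c * 2^n)" "q^n * H (c * 2^n)"]) (auto simp: q_def intro!: prob_le)
    then obtain E where E: "\<And>n. E n \<in> events" "\<And>n. prob (E n) \<le> 2 * (q^n * H (c * 2^n))"
      "\<And>n. {\<omega> \<in> space M. \<exists>s\<in>{0..q^n}. 2 * (2 / (c * 2^n)) < norm (X s \<omega>)} \<subseteq> E n"
      using choice[OF allI, of "\<lambda>n E. E \<in> events \<and> prob E \<le> 2 * (q^n * H (c * 2^n)) \<and>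
        {\<omega> \<in> space M. \<exists>s\<in>{0..q^n}. 2 * (2 / (c * 2^n)) < norm (X s \<omega>)} \<subseteq> E"] by blast
    have "summable (\<lambda>n. prob (E n))"
      by (rule summable_comparison_test[OF _ summable_mult[OF summable[OF that], of 2]])
         (use E(2) in \<open>auto simp: q_def\<close>)
    then have "AE \<omega> in M. \<forall>\<^sub>F n in sequentially. \<omega> \<in> space M - E n"
      using E(1) by (intro borel_cantelli_AE1) (auto simp: emeasure_eq_measure)
    then show ?thesis
    proof eventually_elim
      case (elim \<omega>)
      then obtain N where N: "\<And>n. N \<le> n \<Longrightarrow> \<omega> \<in> space M - E n"
        by (auto simp: eventually_sequentially)
      have "norm (X t \<omega>) / t powr \<kappa> \<le> 8 / c" if t: "0 < t" "t < q^N" for t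
      proof -
        obtain n where n: "N \<le> n" "q^(Suc n) < t" "t \<le> q^n"
          using at_right_0_geometric[of q t N] q t by auto
        have "\<omega> \<notin> {\<omega> \<in> space M. \<exists>s\<in>{0..q^n}. 2 * (2 / (c * 2^n)) < norm (X s \<omega>)}"
          using N[OF n(1)] E(3)[of n] by blast
        then have "\<not> 2 * (2 / (c * 2^n)) < norm (X t \<omega>)"
          using N[OF n(1)] n t by (auto simp del: mult_2 times_divide_eq_right)
        then have "norm (X t \<omega>) \<le> 8 / c * (1 / 2 ^ Suc n)"
          by (simp add: field_simps)
        also have "\<dots> = 8 / c * (q^Suc n) powr \<kappa>" unfolding q_powr ..
        also have "\<dots> \<le> 8 / c * t powr \<kappa>"
          using n q \<open>0 < c\<close> \<open>0 < \<kappa>\<close> by (intro mult_left_mono powr_mono2) auto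
        finally show ?thesis using t by (simp add: field_simps)
      qed
      then show ?case using q by (auto simp: eventually_at_right_field intro!: exI[of _ "q^N"])
    qed
  qed
  have "AE \<omega> in M. \<forall>m::nat. \<forall>\<^sub>F t in at_right 0. norm (X t \<omega>) / t powr \<kappa> \<le> 8 / real (Suc m)"
    by (intro AE_all_countable[THEN iffD2] allI bound) auto
  then show ?thesis
  proof eventually_elim
    case (elim \<omega>)
    show ?case
    proof (rule tendstoI)
      fix e :: real assume "0 < e"
      then obtain m where "8 / real (Suc m) < e"
        using reals_Archimedean[of "e / 8"] by (auto simp: field_simps)
      with elim[rule_format, of m] show "\<forall>\<^sub>F t in at_right 0. dist (norm (X t \<omega>) / t powr \<kappa>) 0 < e"
        by (auto elim: eventually_mono)
    qed
  qed
qed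

section \<open>Lower bound: a trigonometric kernel and independent increments on a fine grid\<close>

text \<open>\<open>R\<close> stands for the real part of the exponent along a line. The order of
  choices matters: \<open>N\<close> makes the weighted sum of \<open>R (2^n)\<close> large, this
  fixes the size \<open>A\<close> of the quadratic bound near the origin, and only then is the
  frequency \<open>m\<close> taken so large that subtracting
  \<open>A / m\<^sup>2 * (1 - cos (m * y))\<close> costs less than \<open>1\<close>. All values
  outside the neighbourhood \<open>\<bar>y\<bar> \<le> 1 / m\<close> are controlled by the bound
  uniform in \<open>N\<close>.\<close>

lemma cosine_kernel:
  fixes R :: "real \<Rightarrow> real"
  assumes "0 < \<alpha>" "\<alpha> < 2"
    and R: "\<And>\<theta>. 0 \<le> R \<theta>" "(\<lambda>n. R (real n) / (real n)\<^sup>2) \<longlonglongrightarrow> 0"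
    and not_summable: "\<not> summable (\<lambda>n. (2 powr -\<alpha>)^n * R (2^n))"
    and C: "\<And>N z. 0 \<le> z \<Longrightarrow> (\<Sum>n<N. (2 powr -\<alpha>)^n * min 1 ((2^n * z)\<^sup>2)) \<le> C * min 1 (z powr \<alpha>)"
  obtains a \<theta> :: "nat \<Rightarrow> real" and N :: nat and \<eta> :: real
  where "0 < \<eta>" "B < (\<Sum>n<N. a n * R (\<theta> n))"
    "\<And>y. (\<Sum>n<N. a n * (1 - cos (\<theta> n * y))) \<le> 2 * C * min 1 (\<bar>y\<bar> powr \<alpha>)"
    "\<And>y. \<bar>y\<bar> \<le> \<eta> \<Longrightarrow> (\<Sum>n<N. a n * (1 - cos (\<theta> n * y))) \<le> 0"
proof -
  define q where "q = 2 powr -\<alpha>"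
  have q: "0 < q" by (simp add: q_def)
  have "\<exists>N. B + 1 \<le> (\<Sum>n<N. q^n * R (2^n))"
  proof (rule ccontr)
    assume "\<not> ?thesis"
    then have "summable (\<lambda>n. q^n * R (2^n))"
      using q R by (intro summableI_nonneg_bounded[of _ "B + 1"]) (auto simp: not_le less_imp_le)
    then show False using not_summable by (simp add: q_def)
  qed
  \<comment> \<open>The surplus \<open>1\<close> over \<open>B\<close> pays for the correction
    term.\<close>
  then obtain N where N: "B + 1 \<le> (\<Sum>n<N. q^n * R (2^n))" ..
  \<comment> \<open>With this factor \<open>2\<close> the estimate
    \<open>1 - cos x \<le> x\<^sup>2 / 2\<close> bounds the sum by \<open>A * y\<^sup>2 / 4\<close>,
    which is just what \<open>one_minus_cos_ge\<close> yields from below for the correction at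
    frequency \<open>m\<close>.\<close>
  define A where "A = 2 * (\<Sum>n<N. q^n * (2^n)\<^sup>2)"
  have A: "0 \<le> A" using q by (auto simp: A_def intro!: sum_nonneg)
  have "(\<lambda>n. A * (R (real n) / (real n)\<^sup>2)) \<longlonglongrightarrow> A * 0"
    by (intro tendsto_intros R)
  then have "\<forall>\<^sub>F n in sequentially. A * (R (real n) / (real n)\<^sup>2) < 1 \<and> 0 < n"
    by (intro eventually_conj order_tendstoD(2) eventually_gt_at_top) auto
  then obtain m :: nat where m: "A * (R (real m) / (real m)\<^sup>2) < 1" "0 < m"
    using eventually_happens'[OF sequentially_bot] by blast
  \<comment> \<open>The correction is stored as the term of index \<open>N\<close>, with a negative
    coefficient, so that the kernel is a single sum of \<open>Suc N\<close> cosine terms.\<close>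
  define a where "a n = (if n < N then q^n else - (A / (real m)\<^sup>2))" for n
  define \<theta> where "\<theta> n = (if n < N then 2^n else real m)" for n
  have sum_eq: "(\<Sum>n<Suc N. a n * f (\<theta> n)) = (\<Sum>n<N. q^n * f (2^n)) - A / (real m)\<^sup>2 * f (real m)" for f
    by (simp add: a_def \<theta>_def)
  show thesis
  proof (rule that)
    show "0 < 1 / real m" using m by simp
    show "B < (\<Sum>n<Suc N. a n * R (\<theta> n))"
    proof -
      have "A / (real m)\<^sup>2 * R (real m) < 1" using m by simp
      then show ?thesis unfolding sum_eq using N by linarith
    qed
    show "(\<Sum>n<Suc N. a n * (1 - cos (\<theta> n * y))) \<le> 2 * C * min 1 (\<bar>y\<bar> powr \<alpha>)" for y
    proof -
      have "(\<Sum>n<Suc N. a n * (1 - cos (\<theta> n * y))) \<le> (\<Sum>n<N. q^n * (1 - cos (2^n * y)))"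
        unfolding sum_eq[of "\<lambda>x. 1 - cos (x * y)"] using A by simp
      also have "\<dots> \<le> (\<Sum>n<N. q^n * (2 * min 1 ((2^n * \<bar>y\<bar>)\<^sup>2)))"
        using q one_minus_cos_le_min[of "2^_ * y"]
        by (intro sum_mono mult_left_mono) (auto simp: power_mult_distrib)
      also have "\<dots> = 2 * (\<Sum>n<N. q^n * min 1 ((2^n * \<bar>y\<bar>)\<^sup>2))"
        by (simp add: sum_distrib_left mult_ac)
      also have "\<dots> \<le> 2 * (C * min 1 (\<bar>y\<bar> powr \<alpha>))"
        using C[of "\<bar>y\<bar>" N] by (simp add: q_def)
      finally show ?thesis by simp
    qed
    show "(\<Sum>n<Suc N. a n * (1 - cos (\<theta> n * y))) \<le> 0" if "\<bar>y\<bar> \<le> 1 / real m" for y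
    proof -
      have "(\<Sum>n<N. q^n * (1 - cos (2^n * y))) \<le> (\<Sum>n<N. q^n * ((2^n * y)\<^sup>2 / 2))"
        using q by (intro sum_mono mult_left_mono one_minus_cos_le) auto
      also have "\<dots> = A * y\<^sup>2 / 4"
        by (simp add: A_def sum_distrib_left sum_distrib_right sum_divide_distrib power_mult_distrib mult_ac)
      also have "\<dots> = A / (real m)\<^sup>2 * ((real m * y)\<^sup>2 / 4)"
        using m by (simp add: power_mult_distrib)
      also have "\<dots> \<le> A / (real m)\<^sup>2 * (1 - cos (real m * y))"
        using that m A by (intro mult_left_mono one_minus_cos_ge) (auto simp: abs_mult field_simps)
      finally show ?thesis unfolding sum_eq[of "\<lambda>x. 1 - cos (x * y)"] by simp
    qed
  qed
qed

text \<open>The points \<open>s, 2 * s, ...\<close> up to \<open>min \<delta> z\<close> number the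
  integer part of \<open>min \<delta> z / s\<close>, and rounding down loses at most half when
  \<open>min \<delta> z \<ge> 2 * s\<close>. This replaces \<open>min \<delta> z\<close> by a sum of
  indicators, whose expectations are tail probabilities.\<close>

lemma min_le_card_grid:
  fixes s \<delta> z :: real
  assumes "0 < s" "2 * s \<le> \<delta>" "2 * s \<le> z"
  shows "min \<delta> z \<le> 2 * s * (\<Sum>k<nat \<lfloor>\<delta> / s\<rfloor>. of_bool (real (Suc k) * s \<le> z))"
proof -
  define w where "w = min \<delta> z"
  define l where "l = nat \<lfloor>w / s\<rfloor>"
  have w: "2 * s \<le> w" "w \<le> \<delta>" "w \<le> z" using assms by (auto simp: w_def)
  have "0 \<le> w / s" using w \<open>0 < s\<close> by simp
  then have l: "real l \<le> w / s" "w / s \<le> real l + 1"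
    unfolding l_def by linarith+
  have "l \<le> nat \<lfloor>\<delta> / s\<rfloor>"
    unfolding l_def using w \<open>0 < s\<close> by (intro nat_mono floor_mono divide_right_mono) auto
  moreover have "real (Suc k) * s \<le> z" if "k < l" for k
  proof -
    have "real (Suc k) * s \<le> real l * s" using that \<open>0 < s\<close> by (intro mult_right_mono) auto
    also have "\<dots> \<le> w" using l \<open>0 < s\<close> by (simp add: field_simps)
    finally show ?thesis using w by simp
  qed
  ultimately have "(\<Sum>k<l. 1) \<le> (\<Sum>k<nat \<lfloor>\<delta> / s\<rfloor>. of_bool (real (Suc k) * s \<le> z) :: real)"
    by (intro sum_le_included[where i = id]) auto
  moreover have "w \<le> 2 * s * real l"
  proof -
    have "w \<le> s * real l + s" using l \<open>0 < s\<close> by (simp add: field_simps)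
    then show ?thesis using w by (simp add: algebra_simps)
  qed
  ultimately have "w \<le> 2 * s * real l" "real l \<le> (\<Sum>k<nat \<lfloor>\<delta> / s\<rfloor>. of_bool (real (Suc k) * s \<le> z))"
    by simp_all
  then show ?thesis
    unfolding w_def[symmetric] using \<open>0 < s\<close> by (elim order_trans) (intro mult_left_mono, auto)
qed

text \<open>For small \<open>s\<close> the expectation of the kernel at \<open>Y s\<close> exceeds
  \<open>4 * C * D * \<bar>B\<bar> * s\<close>. Pointwise the kernel is at most
  \<open>4 * C * D * s\<close> times the number of grid points \<open>u = real (Suc k) * s\<close>
  up to \<open>\<delta>\<close> with
  \<open>2 * c * u powr (1/\<alpha>) \<le> \<bar>Y s\<bar>\<close>. The expectation of that number
  is the sum in the claim.\<close>

lemma exists_grid_sum_ge: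
  fixes Y :: "real \<Rightarrow> 'w \<Rightarrow> real" and R :: "real \<Rightarrow> real"
  assumes "levy_process M Y" and "0 < \<alpha>" "\<alpha> < 2" and "0 < c" "0 < \<delta>"
    and lim: "\<And>\<theta>. ((\<lambda>s. (\<integral>\<omega>. 1 - cos (\<theta> * Y s \<omega>) \<partial>M) / s) \<longlongrightarrow> R \<theta>) (at_right 0)"
    and R: "\<And>\<theta>. 0 \<le> R \<theta>" "(\<lambda>n. R (real n) / (real n)\<^sup>2) \<longlonglongrightarrow> 0"
    and not_summable: "\<not> summable (\<lambda>n. (2 powr -\<alpha>)^n * R (2^n))"
  shows "\<exists>s>0. B \<le> (\<Sum>k<nat \<lfloor>\<delta> / s\<rfloor>.
    measure M {\<omega> \<in> space M. 2 * c * (real (Suc k) * s) powr (1/\<alpha>) \<le> \<bar>Y s \<omega>\<bar>})"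
proof -
  interpret levy_process M Y by fact
  obtain C where C: "0 < C"
    "\<And>N z. 0 \<le> z \<Longrightarrow> (\<Sum>n<N. (2 powr -\<alpha>)^n * min 1 ((2^n * z)\<^sup>2)) \<le> C * min 1 (z powr \<alpha>)"
    by (rule sum_powers_min_square_le[OF assms(2,3)]) blast
  \<comment> \<open>\<open>1 / \<delta>\<close> compares the cap \<open>1\<close> with
    \<open>\<delta>\<close>, and \<open>(2 * c) powr \<alpha>\<close> compensates for rescaling
    \<open>y\<close> by \<open>2 * c\<close>.\<close>
  define D where "D = max (1 / \<delta>) ((2 * c) powr \<alpha>)"
  have D: "0 < D" using \<open>0 < \<delta>\<close> by (simp add: D_def less_max_iff_disj)
  have min_le: "min 1 (\<bar>y\<bar> powr \<alpha>) \<le> D * min \<delta> ((\<bar>y\<bar> / (2 * c)) powr \<alpha>)" for y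
  proof -
    have "min 1 (\<bar>y\<bar> powr \<alpha>) \<le> D * \<delta>"
    proof -
      have "1 / \<delta> * \<delta> \<le> D * \<delta>" using \<open>0 < \<delta>\<close> by (intro mult_right_mono) (auto simp: D_def)
      then show ?thesis using \<open>0 < \<delta>\<close> by simp
    qed
    moreover have "min 1 (\<bar>y\<bar> powr \<alpha>) \<le> D * (\<bar>y\<bar> / (2 * c)) powr \<alpha>"
    proof -
      have "\<bar>y\<bar> powr \<alpha> = (2 * c) powr \<alpha> * (\<bar>y\<bar> / (2 * c)) powr \<alpha>"
        using \<open>0 < c\<close> by (subst powr_mult[symmetric]) auto
      also have "\<dots> \<le> D * (\<bar>y\<bar> / (2 * c)) powr \<alpha>" by (intro mult_right_mono) (auto simp: D_def)
      finally show ?thesis by simp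
    qed
    ultimately show ?thesis using D by (auto simp: min_def)
  qed
  obtain a \<theta> :: "nat \<Rightarrow> real" and N \<eta> where K:
    "0 < \<eta>" "4 * C * D * \<bar>B\<bar> < (\<Sum>n<N. a n * R (\<theta> n))"
    "\<And>y. (\<Sum>n<N. a n * (1 - cos (\<theta> n * y))) \<le> 2 * C * min 1 (\<bar>y\<bar> powr \<alpha>)"
    "\<And>y. \<bar>y\<bar> \<le> \<eta> \<Longrightarrow> (\<Sum>n<N. a n * (1 - cos (\<theta> n * y))) \<le> 0"
    by (rule cosine_kernel[OF assms(2,3) R not_summable C(2), where B="4 * C * D * \<bar>B\<bar>"]) (assumption | rule that)+
  define K where "K y = (\<Sum>n<N. a n * (1 - cos (\<theta> n * y)))" for y
  have EK: "expectation (\<lambda>\<omega>. K (Y s \<omega>)) = (\<Sum>n<N. a n * expectation (\<lambda>\<omega>. 1 - cos (\<theta> n * Y s \<omega>)))"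
    and int_K: "integrable M (\<lambda>\<omega>. K (Y s \<omega>))" if "0 < s" for s
  proof -
    have [measurable]: "random_variable borel (Y s)" using that by (intro measurable_process) auto
    have "integrable M (\<lambda>\<omega>. 1 - cos (\<theta> n * Y s \<omega>))" for n
      by (intro Bochner_Integration.integrable_diff integrable_const integrable_const_bound[of _ 1]) auto
    then show "expectation (\<lambda>\<omega>. K (Y s \<omega>)) = (\<Sum>n<N. a n * expectation (\<lambda>\<omega>. 1 - cos (\<theta> n * Y s \<omega>)))"
      "integrable M (\<lambda>\<omega>. K (Y s \<omega>))"
      unfolding K_def by (simp_all del: Bochner_Integration.integral_diff)
  qed
  define z where "z y = (\<bar>y\<bar> / (2 * c)) powr \<alpha>" for y
  have le_z_iff: "2 * c * t powr (1/\<alpha>) \<le> \<bar>y\<bar> \<longleftrightarrow> t \<le> z y" if "0 \<le> t" for t y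
  proof -
    have "2 * c * t powr (1/\<alpha>) \<le> \<bar>y\<bar> \<longleftrightarrow> t powr (1/\<alpha>) \<le> \<bar>y\<bar> / (2 * c)"
      using \<open>0 < c\<close> by (simp add: field_simps)
    also have "\<dots> \<longleftrightarrow> (t powr (1/\<alpha>)) powr \<alpha> \<le> z y"
      using powr_mono2[of \<alpha> "t powr (1/\<alpha>)" "\<bar>y\<bar> / (2 * c)"]
        powr_less_mono2[of \<alpha> "\<bar>y\<bar> / (2 * c)" "t powr (1/\<alpha>)"] \<open>0 < c\<close> assms(2)
      unfolding z_def by (auto simp: not_le[symmetric])
    also have "(t powr (1/\<alpha>)) powr \<alpha> = t" using that assms(2) by (simp add: powr_powr)
    finally show ?thesis .
  qed
  \<comment> \<open>Below \<open>s0\<close> the mesh is fine enough for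
    \<open>min_le_card_grid\<close> at every \<open>\<bar>y\<bar> > \<eta>\<close>. Smaller values
    of \<open>y\<close> may fall below the resolution of the grid; there the kernel is nonpositive
    and nothing has to be counted.\<close>
  define s0 where "s0 = min \<delta> (z \<eta>) / 2"
  have s0: "0 < s0" using K(1) \<open>0 < c\<close> \<open>0 < \<delta>\<close> by (simp add: s0_def z_def)
  have "((\<lambda>s. \<Sum>n<N. a n * (expectation (\<lambda>\<omega>. 1 - cos (\<theta> n * Y s \<omega>)) / s)) \<longlongrightarrow> (\<Sum>n<N. a n * R (\<theta> n))) (at_right 0)"
    by (intro tendsto_intros lim)
  from order_tendstoD(1)[OF this K(2)] eventually_at_right_real[OF s0]
  have "\<forall>\<^sub>F s in at_right 0. 4 * C * D * \<bar>B\<bar> < (\<Sum>n<N. a n * (expectation (\<lambda>\<omega>. 1 - cos (\<theta> n * Y s \<omega>)) / s)) \<and> 0 < s \<and> s < s0"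
    by eventually_elim auto
  then obtain s where s: "4 * C * D * \<bar>B\<bar> < (\<Sum>n<N. a n * (expectation (\<lambda>\<omega>. 1 - cos (\<theta> n * Y s \<omega>)) / s))" "0 < s" "s < s0"
    using eventually_happens'[OF trivial_limit_at_right_real] by blast
  have [measurable]: "random_variable borel (Y s)" using s by (intro measurable_process) auto
  have "4 * C * D * \<bar>B\<bar> < (\<Sum>n<N. a n * expectation (\<lambda>\<omega>. 1 - cos (\<theta> n * Y s \<omega>))) / s"
    using s(1) by (simp add: sum_divide_distrib)
  then have "4 * C * D * \<bar>B\<bar> * s < expectation (\<lambda>\<omega>. K (Y s \<omega>))"
    using s by (simp add: EK field_simps)
  also have "\<dots> \<le> expectation (\<lambda>\<omega>. 4 * C * D * s * (\<Sum>k<nat \<lfloor>\<delta> / s\<rfloor>. indicator {\<omega> \<in> space M. 2 * c * (real (Suc k) * s) powr (1/\<alpha>) \<le> \<bar>Y s \<omega>\<bar>} \<omega>))"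
  proof (intro integral_mono int_K s)
    fix \<omega> assume "\<omega> \<in> space M"
    define y where "y = Y s \<omega>"
    have "K y \<le> 4 * C * D * s * (\<Sum>k<nat \<lfloor>\<delta> / s\<rfloor>. of_bool (real (Suc k) * s \<le> z y))"
    proof (cases "\<bar>y\<bar> \<le> \<eta>")
      case True
      then have "K y \<le> 0" unfolding K_def by (rule K(4))
      also have "0 \<le> 4 * C * D * s * (\<Sum>k<nat \<lfloor>\<delta> / s\<rfloor>. of_bool (real (Suc k) * s \<le> z y))"
        using C D s by (auto intro!: mult_nonneg_nonneg sum_nonneg)
      finally show ?thesis .
    next
      case False
      then have "z \<eta> \<le> z y" using K(1) \<open>0 < c\<close> assms(2)
        unfolding z_def by (intro powr_mono2 divide_right_mono) auto
      then have "2 * s \<le> \<delta>" "2 * s \<le> z y" using s by (auto simp: s0_def)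
      note grid = min_le_card_grid[OF s(2) this]
      have "K y \<le> 2 * C * min 1 (\<bar>y\<bar> powr \<alpha>)" unfolding K_def by (rule K(3))
      also have "\<dots> \<le> 2 * C * (D * min \<delta> (z y))"
        using C by (intro mult_left_mono) (auto simp: z_def min_le)
      also have "\<dots> \<le> 2 * C * (D * (2 * s * (\<Sum>k<nat \<lfloor>\<delta> / s\<rfloor>. of_bool (real (Suc k) * s \<le> z y))))"
        using C D grid by (intro mult_left_mono) auto
      finally show ?thesis by (simp add: mult_ac)
    qed
    also have "(\<Sum>k<nat \<lfloor>\<delta> / s\<rfloor>. of_bool (real (Suc k) * s \<le> z y))
        = (\<Sum>k<nat \<lfloor>\<delta> / s\<rfloor>. indicator {\<omega> \<in> space M. 2 * c * (real (Suc k) * s) powr (1/\<alpha>) \<le> \<bar>Y s \<omega>\<bar>} \<omega> :: real)"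
    proof (intro sum.cong refl)
      fix k
      show "of_bool (real (Suc k) * s \<le> z y) = (indicator {\<omega> \<in> space M. 2 * c * (real (Suc k) * s) powr (1/\<alpha>) \<le> \<bar>Y s \<omega>\<bar>} \<omega> :: real)"
        using le_z_iff[of "real (Suc k) * s" y] s \<open>\<omega> \<in> space M\<close> by (simp add: y_def indicator_def del: of_nat_Suc)
    qed
    finally show "K (Y s \<omega>) \<le> 4 * C * D * s * (\<Sum>k<nat \<lfloor>\<delta> / s\<rfloor>. indicator {\<omega> \<in> space M. 2 * c * (real (Suc k) * s) powr (1/\<alpha>) \<le> \<bar>Y s \<omega>\<bar>} \<omega>)"
      by (simp add: y_def)
  qed (auto intro!: integrable_real_indicator simp: emeasure_eq_measure)
  also have "\<dots> = 4 * C * D * s * (\<Sum>k<nat \<lfloor>\<delta> / s\<rfloor>. prob {\<omega> \<in> space M. 2 * c * (real (Suc k) * s) powr (1/\<alpha>) \<le> \<bar>Y s \<omega>\<bar>})"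
    by (simp add: emeasure_eq_measure del: of_nat_Suc)
  finally have "(4 * C * D * s) * \<bar>B\<bar> < (4 * C * D * s) * (\<Sum>k<nat \<lfloor>\<delta> / s\<rfloor>. prob {\<omega> \<in> space M. 2 * c * (real (Suc k) * s) powr (1/\<alpha>) \<le> \<bar>Y s \<omega>\<bar>})"
    by (simp only: mult_ac)
  then have "\<bar>B\<bar> < (\<Sum>k<nat \<lfloor>\<delta> / s\<rfloor>. prob {\<omega> \<in> space M. 2 * c * (real (Suc k) * s) powr (1/\<alpha>) \<le> \<bar>Y s \<omega>\<bar>})"
    using C D s by (subst (asm) mult_less_cancel_left_pos) auto
  then show ?thesis using s by (intro exI[of _ s]) auto
qed

text \<open>A path below \<open>c * u powr (1/\<alpha>)\<close> at all \<open>u\<close> in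
  \<open>(0, \<delta>]\<close> has every grid increment below
  \<open>2 * c * u powr (1/\<alpha>)\<close>, where \<open>u\<close> is the right end of the step.
  By independence this has probability at most \<open>exp\<close> of minus the sum of the tail
  probabilities, hence at most \<open>exp (- B)\<close>. The mesh depends on \<open>B\<close>, and
  intersecting over all \<open>B\<close> leaves a null set.\<close>

lemma AE_exists_large_value:
  fixes Y :: "real \<Rightarrow> 'w \<Rightarrow> real" and R :: "real \<Rightarrow> real"
  assumes "levy_process M Y" and "0 < \<alpha>" "\<alpha> < 2" and "0 < c" "0 < \<delta>"
    and "\<And>\<theta>. ((\<lambda>s. (\<integral>\<omega>. 1 - cos (\<theta> * Y s \<omega>) \<partial>M) / s) \<longlongrightarrow> R \<theta>) (at_right 0)"
    and "\<And>\<theta>. 0 \<le> R \<theta>" "(\<lambda>n. R (real n) / (real n)\<^sup>2) \<longlonglongrightarrow> 0"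
    and "\<not> summable (\<lambda>n. (2 powr -\<alpha>)^n * R (2^n))"
  shows "AE \<omega> in M. \<exists>u\<in>{0<..\<delta>}. c * u powr (1/\<alpha>) \<le> \<bar>Y u \<omega>\<bar>"
proof -
  interpret levy_process M Y by fact
  have "\<exists>E\<in>events. prob E \<le> exp (- real B) \<and> {\<omega> \<in> space M. \<forall>u\<in>{0<..\<delta>}. \<bar>Y u \<omega>\<bar> < c * u powr (1/\<alpha>)} \<subseteq> E" for B :: nat
  proof -
    obtain s where s: "0 < s" "real B + 1 \<le> (\<Sum>k<nat \<lfloor>\<delta> / s\<rfloor>.
        prob {\<omega> \<in> space M. 2 * c * (real (Suc k) * s) powr (1/\<alpha>) \<le> \<bar>Y s \<omega>\<bar>})"
      using exists_grid_sum_ge[OF assms, of "real B + 1"] by auto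
    define m where "m = nat \<lfloor>\<delta> / s\<rfloor>"
    \<comment> \<open>Asking for \<open>B + 1\<close> instead of \<open>B\<close> keeps the sum
      positive even for \<open>B = 0\<close>, so the grid is nonempty, as the product formula for
      independent events and the finite intersection require.\<close>
    have "m \<noteq> 0" using s(2) unfolding m_def[symmetric] by (intro notI) simp
    have m: "real m * s \<le> \<delta>"
    proof -
      have "real m \<le> \<delta> / s" using \<open>0 < \<delta>\<close> s(1) by (simp add: m_def)
      then show ?thesis using s(1) by (simp add: field_simps)
    qed
    define A where "A k = {y::real. \<bar>y\<bar> < 2 * c * (real (Suc k) * s) powr (1/\<alpha>)}" for k
    have [measurable]: "A k \<in> sets borel" for k unfolding A_def by measurable
    have [measurable]: "random_variable borel (Y (real k * s))" "random_variable borel (Y s)" for k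
      using s by (auto intro: measurable_process)
    let ?D = "\<lambda>k \<omega>. Y (real (Suc k) * s) \<omega> - Y (real k * s) \<omega>"
    define E where "E = (\<Inter>k\<in>{..<m}. ?D k -` A k \<inter> space M)"
    have "prob E = (\<Prod>k<m. prob (?D k -` A k \<inter> space M))"
      unfolding E_def using s \<open>m \<noteq> 0\<close>
      by (intro indep_varsD[OF indep_vars_grid[of s m]]) auto
    also have "\<dots> \<le> (\<Prod>k<m. exp (- prob {\<omega> \<in> space M. 2 * c * (real (Suc k) * s) powr (1/\<alpha>) \<le> \<bar>Y s \<omega>\<bar>}))"
    proof (intro prod_mono conjI measure_nonneg)
      fix k
      have eq: "real (Suc k) * s = real k * s + s" by (simp add: algebra_simps)
      have "prob (?D k -` A k \<inter> space M) = prob {\<omega> \<in> space M. Y (real k * s + s) \<omega> - Y (real k * s) \<omega> \<in> A k}"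
        unfolding eq by (intro arg_cong[where f=prob]) auto
      also have "\<dots> = prob {\<omega> \<in> space M. Y s \<omega> \<in> A k}"
        using s by (intro prob_increment) auto
      also have "{\<omega> \<in> space M. Y s \<omega> \<in> A k} = space M - {\<omega> \<in> space M. 2 * c * (real (Suc k) * s) powr (1/\<alpha>) \<le> \<bar>Y s \<omega>\<bar>}"
        by (auto simp: A_def)
      also have "prob \<dots> = 1 - prob {\<omega> \<in> space M. 2 * c * (real (Suc k) * s) powr (1/\<alpha>) \<le> \<bar>Y s \<omega>\<bar>}"
        by (intro prob_compl) measurable
      also have "\<dots> \<le> exp (- prob {\<omega> \<in> space M. 2 * c * (real (Suc k) * s) powr (1/\<alpha>) \<le> \<bar>Y s \<omega>\<bar>})"
        using exp_ge_add_one_self[of "- prob {\<omega> \<in> space M. 2 * c * (real (Suc k) * s) powr (1/\<alpha>) \<le> \<bar>Y s \<omega>\<bar>}"] by simp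
      finally show "prob (?D k -` A k \<inter> space M) \<le> \<dots>" .
    qed
    also have "\<dots> = exp (- (\<Sum>k<m. prob {\<omega> \<in> space M. 2 * c * (real (Suc k) * s) powr (1/\<alpha>) \<le> \<bar>Y s \<omega>\<bar>}))"
      by (simp add: exp_sum sum_negf[symmetric])
    also have "\<dots> \<le> exp (- real B)" using s(2) by (simp add: m_def)
    finally have "prob E \<le> exp (- real B)" .
    moreover have "E \<in> events"
      unfolding E_def using \<open>m \<noteq> 0\<close> by (intro sets.finite_INT) (auto simp del: of_nat_Suc)
    moreover have "{\<omega> \<in> space M. \<forall>u\<in>{0<..\<delta>}. \<bar>Y u \<omega>\<bar> < c * u powr (1/\<alpha>)} \<subseteq> E"
    proof
      fix \<omega> assume \<omega>: "\<omega> \<in> {\<omega> \<in> space M. \<forall>u\<in>{0<..\<delta>}. \<bar>Y u \<omega>\<bar> < c * u powr (1/\<alpha>)}"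
      \<comment> \<open>At \<open>j = 0\<close> both sides vanish, so only the weak inequality
        survives there. It suffices for the left end of an increment; the right end supplies
        strictness.\<close>
      have Y: "\<bar>Y (real j * s) \<omega>\<bar> \<le> c * (real j * s) powr (1/\<alpha>)" "0 < j \<Longrightarrow> \<bar>Y (real j * s) \<omega>\<bar> < c * (real j * s) powr (1/\<alpha>)" if "j \<le> m" for j
      proof -
        have "real j * s \<le> \<delta>" using m that s(1) mult_right_mono[of "real j" "real m" s] by linarith
        then show *: "\<bar>Y (real j * s) \<omega>\<bar> < c * (real j * s) powr (1/\<alpha>)" if "0 < j"
          using \<omega> that s(1) by auto
        show "\<bar>Y (real j * s) \<omega>\<bar> \<le> c * (real j * s) powr (1/\<alpha>)"
          using * start_zero[of \<omega>] \<omega> by (cases "j = 0") auto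
      qed
      have "?D k \<omega> \<in> A k" if "k < m" for k
      proof -
        have "c * (real k * s) powr (1/\<alpha>) \<le> c * (real (Suc k) * s) powr (1/\<alpha>)"
          using s(1) assms(2,4) by (intro mult_left_mono powr_mono2 mult_right_mono) auto
        then have "\<bar>?D k \<omega>\<bar> < 2 * c * (real (Suc k) * s) powr (1/\<alpha>)"
          using Y(1)[of k] Y(2)[of "Suc k"] that by linarith
        then show ?thesis by (simp add: A_def)
      qed
      then show "\<omega> \<in> E" using \<omega> by (auto simp: E_def)
    qed
    ultimately show ?thesis by blast
  qed
  then obtain E where E: "\<And>B. E B \<in> events" "\<And>B. prob (E B) \<le> exp (- real B)"
    "\<And>B. {\<omega> \<in> space M. \<forall>u\<in>{0<..\<delta>}. \<bar>Y u \<omega>\<bar> < c * u powr (1/\<alpha>)} \<subseteq> E B"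
    using bchoice[of UNIV "\<lambda>B E. E \<in> events \<and> prob E \<le> exp (- real B) \<and>
      {\<omega> \<in> space M. \<forall>u\<in>{0<..\<delta>}. \<bar>Y u \<omega>\<bar> < c * u powr (1/\<alpha>)} \<subseteq> E"] by blast
  have sets: "(\<Inter>B. E B) \<in> events" using E(1) by auto
  have "prob (\<Inter>B. E B) \<le> 0"
  proof (rule LIMSEQ_le_const)
    show "(\<lambda>B. exp (- real B)) \<longlonglongrightarrow> 0"
      using LIMSEQ_power_zero[of "exp (-1 :: real)"] by (simp flip: exp_of_nat_mult)
    have "prob (\<Inter>B. E B) \<le> exp (- real B)" for B
      using E(1) by (intro order_trans[OF finite_measure_mono E(2)[of B]]) auto
    then show "\<exists>N. \<forall>n\<ge>N. prob (\<Inter>B. E B) \<le> exp (- real n)" by blast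
  qed
  then have "(\<Inter>B. E B) \<in> null_sets M"
    using sets by (auto simp: null_sets_def emeasure_eq_measure measure_le_0_iff)
  moreover have "{\<omega> \<in> space M. \<not> (\<exists>u\<in>{0<..\<delta>}. c * u powr (1/\<alpha>) \<le> \<bar>Y u \<omega>\<bar>)} \<subseteq> (\<Inter>B. E B)"
    using E(3) by (auto simp: not_le)
  ultimately show ?thesis by (rule AE_I')
qed

section \<open>The characteristic exponent\<close>

text \<open>Twice this quantity dominates the real part of the exponent on the ball of radius
  \<open>u\<close>, by \<open>real_exponent_le\<close>; it therefore controls tails at distance
  \<open>2 / u\<close>.\<close>

definition truncated_moment :: "'a::euclidean_space measure \<Rightarrow> real \<Rightarrow> real" where
  "truncated_moment \<nu> u = (\<integral>y. min 1 ((u * norm y)\<^sup>2) \<partial>\<nu>)"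

text \<open>The real part of the characteristic exponent in the case \<open>Q = 0\<close>; see
  \<open>Re_levy_exponent\<close>.\<close>

definition real_exponent :: "'a::euclidean_space measure \<Rightarrow> 'a \<Rightarrow> real" where
  "real_exponent \<nu> \<xi> = (\<integral>y. 1 - cos (y \<bullet> \<xi>) \<partial>\<nu>)"

lemma real_exponent_nonneg: "0 \<le> real_exponent \<nu> \<xi>"
  unfolding real_exponent_def by (intro integral_nonneg_AE) auto

lemma min_square_mult_le:
  fixes u x :: real
  shows "min 1 ((u * x)\<^sup>2) \<le> (1 + u\<^sup>2) * min 1 (x\<^sup>2)"
proof (cases "x\<^sup>2 \<le> 1")
  case True
  have "min 1 ((u * x)\<^sup>2) \<le> u\<^sup>2 * x\<^sup>2" by (simp add: power_mult_distrib)
  also have "\<dots> \<le> (1 + u\<^sup>2) * x\<^sup>2" by (intro mult_right_mono) auto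
  finally show ?thesis using True by (simp add: min_def)
next
  case False
  have "min 1 ((u * x)\<^sup>2) \<le> 1 + u\<^sup>2" by (simp add: min.coboundedI1)
  then show ?thesis using False by (simp add: min_absorb1)
qed

text \<open>For \<open>norm y < 1\<close> the compensator cancels the linear Taylor term and leaves
  a quadratic remainder; for \<open>norm y \<ge> 1\<close> it is absent and the integrand is at most
  \<open>2\<close>. The resulting integrability lets the real part pass through the Bochner
  integral.\<close>

lemma norm_exponent_integrand_le:
  fixes y \<xi> :: "'a::euclidean_space"
  shows "norm (1 - exp (\<i> * complex_of_real (y \<bullet> \<xi>)) + \<i> * complex_of_real ((y \<bullet> \<xi>) * indicator {0<..<1} (norm y)))
    \<le> (2 + (norm \<xi>)\<^sup>2) * min 1 ((norm y)\<^sup>2)"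
proof -
  define z where "z = y \<bullet> \<xi>"
  have z: "z\<^sup>2 \<le> (norm \<xi>)\<^sup>2 * (norm y)\<^sup>2"
    using Cauchy_Schwarz_ineq2[of y \<xi>] abs_le_square_iff[of z "norm y * norm \<xi>"]
    by (simp add: z_def power_mult_distrib mult_ac)
  consider "y = 0" | "0 < norm y" "norm y < 1" | "1 \<le> norm y" by force
  then show ?thesis
  proof cases
    case 2
    have "cmod (1 - exp (\<i> * complex_of_real z) + \<i> * complex_of_real z) = cmod (iexp z - (\<Sum>k\<le>1. (\<i> * z)^k / fact k))"
      by (subst norm_minus_cancel[symmetric]) (simp add: algebra_simps)
    also have "\<dots> \<le> \<bar>z\<bar>^(Suc 1) / fact (Suc 1)" by (rule iexp_approx1)
    also have "\<bar>z\<bar>^(Suc 1) / fact (Suc 1) = z\<^sup>2 / 2"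
      by (simp add: power2_eq_square)
    also have "\<dots> \<le> (norm \<xi>)\<^sup>2 * (norm y)\<^sup>2"
      using z zero_le_power2[of z] by linarith
    also have "\<dots> \<le> (2 + (norm \<xi>)\<^sup>2) * min 1 ((norm y)\<^sup>2)"
    proof -
      have "(norm y)\<^sup>2 \<le> 1" using 2 by (simp add: power_le_one)
      then show ?thesis by (simp add: min_absorb2 distrib_right)
    qed
    finally show ?thesis using 2 by (simp add: z_def)
  next
    case 3
    have "cmod (1 - exp (\<i> * complex_of_real z)) \<le> cmod 1 + cmod (exp (\<i> * complex_of_real z))"
      by (rule norm_triangle_ineq4)
    also have "\<dots> \<le> (2 + (norm \<xi>)\<^sup>2) * min 1 ((norm y)\<^sup>2)"
      using 3 by (simp add: min_def one_le_power)
    finally show ?thesis using 3 by (simp add: z_def)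
  qed simp
qed

lemma one_minus_cos_inner_le:
  fixes y \<xi> :: "'a::euclidean_space"
  assumes "norm \<xi> \<le> u"
  shows "1 - cos (y \<bullet> \<xi>) \<le> 2 * min 1 ((u * norm y)\<^sup>2)"
proof -
  have "\<bar>y \<bullet> \<xi>\<bar> \<le> norm y * norm \<xi>" by (rule Cauchy_Schwarz_ineq2)
  also have "\<dots> \<le> norm y * u" using assms by (intro mult_left_mono) auto
  finally have "(y \<bullet> \<xi>)\<^sup>2 \<le> (u * norm y)\<^sup>2"
    using power_mono[of "\<bar>y \<bullet> \<xi>\<bar>" "u * norm y" 2] by (simp add: mult.commute)
  then have "min 1 ((y \<bullet> \<xi>)\<^sup>2) \<le> min 1 ((u * norm y)\<^sup>2)" by (intro min.mono) auto
  then show ?thesis using one_minus_cos_le_min[of "y \<bullet> \<xi>"] by linarith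
qed

context
  fixes \<nu> :: "'a::euclidean_space measure"
  assumes \<nu>: "levy_measure \<nu>"
begin

lemma sets_levy_measure: "sets \<nu> = sets borel"
  and nn_integral_min_square_finite: "(\<integral>\<^sup>+y. ennreal (min 1 ((norm y)\<^sup>2)) \<partial>\<nu>) < \<infinity>"
  using \<nu> by (auto simp: levy_measure_def)

lemma integrable_min_square: "integrable \<nu> (\<lambda>y. min 1 ((u * norm y)\<^sup>2))"
proof -
  note [measurable_cong] = sets_levy_measure
  have "integrable \<nu> (\<lambda>y. min 1 ((norm y)\<^sup>2))"
    using nn_integral_min_square_finite by (intro integrableI_nonneg) auto
  then have "integrable \<nu> (\<lambda>y. (1 + u\<^sup>2) * min 1 ((norm y)\<^sup>2))" by simp
  then show ?thesis
  proof (rule Bochner_Integration.integrable_bound)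
    show "AE y in \<nu>. norm (min 1 ((u * norm y)\<^sup>2)) \<le> norm ((1 + u\<^sup>2) * min 1 ((norm y)\<^sup>2))"
      using min_square_mult_le[of u "norm _"] by (intro AE_I2) (auto simp: abs_mult)
  qed measurable
qed

lemma ennreal_truncated_moment:
  "ennreal (truncated_moment \<nu> u) = (\<integral>\<^sup>+y. ennreal (min 1 ((u * norm y)\<^sup>2)) \<partial>\<nu>)"
  unfolding truncated_moment_def
  by (intro nn_integral_eq_integral[symmetric] integrable_min_square) auto

lemma truncated_moment_nonneg: "0 \<le> truncated_moment \<nu> u"
  unfolding truncated_moment_def by (intro integral_nonneg_AE) auto

lemma integrable_one_minus_cos: "integrable \<nu> (\<lambda>y. 1 - cos (y \<bullet> \<xi>))"
proof (rule Bochner_Integration.integrable_bound)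
  note [measurable_cong] = sets_levy_measure
  show "integrable \<nu> (\<lambda>y. 2 * min 1 ((norm \<xi> * norm y)\<^sup>2))"
    by (intro integrable_mult_right integrable_min_square)
  show "AE y in \<nu>. norm (1 - cos (y \<bullet> \<xi>)) \<le> norm (2 * min 1 ((norm \<xi> * norm y)\<^sup>2))"
    using one_minus_cos_inner_le[of \<xi> "norm \<xi>"] by (intro AE_I2) auto
  show "(\<lambda>y. 1 - cos (y \<bullet> \<xi>)) \<in> borel_measurable \<nu>" by measurable
qed

lemma real_exponent_le: "norm \<xi> \<le> u \<Longrightarrow> real_exponent \<nu> \<xi> \<le> 2 * truncated_moment \<nu> u"
  unfolding real_exponent_def truncated_moment_def
  by (subst integral_mult_right_zero[symmetric])
     (intro integral_mono integrable_one_minus_cos integrable_mult_right integrable_min_square one_minus_cos_inner_le)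

lemma Re_levy_exponent: "Re (levy_exponent b (\<lambda>_. 0) \<nu> \<xi>) = real_exponent \<nu> \<xi>"
proof -
  note [measurable_cong] = sets_levy_measure
  let ?f = "\<lambda>y. 1 - exp (\<i> * complex_of_real (y \<bullet> \<xi>)) + \<i> * complex_of_real ((y \<bullet> \<xi>) * indicator {0<..<1} (norm y))"
  have "integrable \<nu> (\<lambda>y. (2 + (norm \<xi>)\<^sup>2) * min 1 ((1 * norm y)\<^sup>2))"
    by (intro integrable_mult_right integrable_min_square)
  then have "integrable \<nu> ?f"
    by (rule Bochner_Integration.integrable_bound)
       (use norm_exponent_integrand_le[of _ \<xi>] in \<open>auto intro!: AE_I2 simp: abs_mult\<close>)
  then have "Re (\<integral>y. ?f y \<partial>\<nu>) = (\<integral>y. Re (?f y) \<partial>\<nu>)" by (rule integral_Re[symmetric])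
  also have "\<dots> = real_exponent \<nu> \<xi>"
    unfolding real_exponent_def by (intro Bochner_Integration.integral_cong) (auto simp: Re_exp)
  finally show ?thesis by (simp add: levy_exponent_def)
qed

text \<open>This expresses the absence of a Gaussian part. The integrand is at most
  \<open>2 / (real n)\<^sup>2\<close>, so it tends to zero pointwise. Taking the factor
  \<open>(real n)\<^sup>2 \<ge> 1\<close> out of the minimum gives a majorant independent of
  \<open>n\<close>; at \<open>n = 0\<close> the quotient is \<open>0\<close> by the convention for
  division.\<close>

lemma real_exponent_div_square_tendsto_0:
  "(\<lambda>n. real_exponent \<nu> (real n *\<^sub>R \<xi>) / (real n)\<^sup>2) \<longlonglongrightarrow> 0"
proof -
  note [measurable_cong] = sets_levy_measure
  have "(\<lambda>n. \<integral>y. (1 - cos (y \<bullet> (real n *\<^sub>R \<xi>))) / (real n)\<^sup>2 \<partial>\<nu>) \<longlonglongrightarrow> (\<integral>y. 0 \<partial>\<nu>)"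
  proof (rule integral_dominated_convergence)
    show "integrable \<nu> (\<lambda>y. 2 * min 1 ((norm \<xi> * norm y)\<^sup>2))"
      by (intro integrable_mult_right integrable_min_square)
    have lim: "(\<lambda>n. 2 / (real n)\<^sup>2) \<longlonglongrightarrow> 0"
      by (intro tendsto_divide_0[OF tendsto_const] filterlim_at_top_imp_at_infinity
          filterlim_pow_at_top filterlim_real_sequentially) simp
    show "AE y in \<nu>. (\<lambda>n. (1 - cos (y \<bullet> (real n *\<^sub>R \<xi>))) / (real n)\<^sup>2) \<longlonglongrightarrow> 0"
    proof (rule AE_I2)
      fix y
      have "norm ((1 - cos (y \<bullet> (real n *\<^sub>R \<xi>))) / (real n)\<^sup>2) \<le> norm (2 / (real n)\<^sup>2) * 1" for n
      proof -
        have "\<bar>1 - cos (y \<bullet> (real n *\<^sub>R \<xi>))\<bar> \<le> 2"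
          using cos_ge_minus_one[of "y \<bullet> (real n *\<^sub>R \<xi>)"] cos_le_one[of "y \<bullet> (real n *\<^sub>R \<xi>)"]
          by linarith
        then show ?thesis unfolding real_norm_def abs_divide by (simp add: divide_right_mono)
      qed
      then show "(\<lambda>n. (1 - cos (y \<bullet> (real n *\<^sub>R \<xi>))) / (real n)\<^sup>2) \<longlonglongrightarrow> 0"
        by (intro tendsto_0_le[OF lim] always_eventually allI)
    qed
    show "AE y in \<nu>. norm ((1 - cos (y \<bullet> (real n *\<^sub>R \<xi>))) / (real n)\<^sup>2) \<le> 2 * min 1 ((norm \<xi> * norm y)\<^sup>2)" for n
    proof (rule AE_I2)
      fix y
      show "norm ((1 - cos (y \<bullet> (real n *\<^sub>R \<xi>))) / (real n)\<^sup>2) \<le> 2 * min 1 ((norm \<xi> * norm y)\<^sup>2)"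
      proof (cases "n = 0")
        case False
        have n: "1 \<le> (real n)\<^sup>2" using False by (intro one_le_power) simp
        have "1 - cos (y \<bullet> (real n *\<^sub>R \<xi>)) \<le> 2 * min 1 ((real n * (norm \<xi> * norm y))\<^sup>2)"
          using one_minus_cos_inner_le[of "real n *\<^sub>R \<xi>" "real n * norm \<xi>" y] by (simp add: mult_ac)
        also have "min 1 ((real n * (norm \<xi> * norm y))\<^sup>2) \<le> (real n)\<^sup>2 * min 1 ((norm \<xi> * norm y)\<^sup>2)"
        proof (cases "(norm \<xi> * norm y)\<^sup>2 \<le> 1")
          case True
          then show ?thesis by (simp add: min_absorb2 power_mult_distrib)
        next
          case False
          then show ?thesis using n by (simp add: min_absorb1)
        qed
        finally have "(1 - cos (y \<bullet> (real n *\<^sub>R \<xi>))) / (real n)\<^sup>2 \<le> 2 * min 1 ((norm \<xi> * norm y)\<^sup>2)"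
          using n False by (subst pos_divide_le_eq) (auto simp: mult_ac)
        then show ?thesis by simp
      qed simp
    qed
  qed measurable
  then show ?thesis by (simp add: real_exponent_def)
qed

end

section \<open>Coordinates of the process and the two almost sure criteria\<close>

lemma levy_process_inner:
  assumes "levy_process M X"
  shows "levy_process M (\<lambda>t \<omega>. X t \<omega> \<bullet> e)"
proof -
  interpret levy_process M X by fact
  show ?thesis
  proof
    show "random_variable borel (\<lambda>\<omega>. X t \<omega> \<bullet> e)" if "0 \<le> t" for t
      using measurable_process[OF that] by measurable
    show "X 0 \<omega> \<bullet> e = 0" if "\<omega> \<in> space M" for \<omega>
      using start_zero[OF that] by simp
    show "distr M borel (\<lambda>\<omega>. X (s + t) \<omega> \<bullet> e - X s \<omega> \<bullet> e) = distr M borel (\<lambda>\<omega>. X t \<omega> \<bullet> e - X 0 \<omega> \<bullet> e)"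
      if "0 \<le> s" "0 \<le> t" for s t
    proof -
      have [measurable]: "random_variable borel (X (s + t))" "random_variable borel (X s)"
        "random_variable borel (X t)" "random_variable borel (X 0)"
        using that by (auto intro: measurable_process)
      have "distr (distr M borel (\<lambda>\<omega>. X (s + t) \<omega> - X s \<omega>)) borel (\<lambda>x. x \<bullet> e)
          = distr (distr M borel (\<lambda>\<omega>. X t \<omega> - X 0 \<omega>)) borel (\<lambda>x. x \<bullet> e)"
        using that by (simp add: stationary_increments)
      then show ?thesis
        by (subst (asm) (1 2) distr_distr) (auto simp: comp_def inner_diff_left)
    qed
    show "indep_vars (\<lambda>_. borel) (\<lambda>j \<omega>. X (\<tau> (Suc j)) \<omega> \<bullet> e - X (\<tau> j) \<omega> \<bullet> e) {..<n}"
      if "0 \<le> \<tau> 0" "mono_on {..n} \<tau>" for \<tau> :: "nat \<Rightarrow> real" and n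
      using indep_vars_compose2[OF independent_increments[OF that], of "\<lambda>_ x. x \<bullet> e" "\<lambda>_. borel"]
      by (simp add: inner_diff_left)
    show "cadlag (\<lambda>t. X t \<omega> \<bullet> e)" if "\<omega> \<in> space M" for \<omega>
    proof -
      have "\<exists>l. ((\<lambda>t. X t \<omega> \<bullet> e) \<longlongrightarrow> l) (at_left t)" if t: "0 < t" for t
      proof -
        obtain l where "((\<lambda>t. X t \<omega>) \<longlongrightarrow> l) (at_left t)"
          using cadlag_paths[OF \<open>\<omega> \<in> space M\<close>] t by (auto simp: cadlag_def)
        then show ?thesis by (intro exI[of _ "l \<bullet> e"] tendsto_intros)
      qed
      then show ?thesis
        using cadlag_paths[OF that] unfolding cadlag_def by (auto intro!: tendsto_inner)
    qed
  qed
qed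

text \<open>The left side equals \<open>(1 - exp (- a)) + exp (- a) * (1 - cos b)\<close>, with
  summands at most \<open>a\<close> and \<open>\<bar>b\<bar>\<close>. Applied with
  \<open>a = t * Re \<psi>\<close> and \<open>b = t * Im \<psi>\<close>, the bound is linear in
  \<open>t\<close>, and the sector condition absorbs the second term into the first.\<close>

lemma one_minus_exp_cos_le:
  fixes a b :: real
  assumes "0 \<le> a"
  shows "1 - exp (- a) * cos b \<le> a + \<bar>b\<bar>"
proof -
  have "1 - cos b \<le> \<bar>b\<bar>"
  proof (cases "\<bar>b\<bar> \<le> 2")
    case True
    then have "b\<^sup>2 / 2 \<le> \<bar>b\<bar>"
      using mult_right_mono[of "\<bar>b\<bar>" 2 "\<bar>b\<bar>"] by (simp add: power2_eq_square flip: abs_mult)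
    then show ?thesis using one_minus_cos_le[of b] by linarith
  next
    case False
    then show ?thesis using cos_ge_minus_one[of b] by linarith
  qed
  moreover have "exp (- a) * (1 - cos b) \<le> 1 - cos b"
    using assms by (intro mult_left_le_one_le) auto
  moreover have "1 - a \<le> exp (- a)" using exp_ge_add_one_self[of "- a"] by simp
  ultimately show ?thesis by (simp add: algebra_simps)
qed

lemma expectation_one_minus_cos:
  assumes "levy_process M X" "has_levy_triplet M X b (\<lambda>_. 0) \<nu>" "0 \<le> t"
  shows "(\<integral>\<omega>. 1 - cos (\<theta> * (X t \<omega> \<bullet> e)) \<partial>M) = 1 - exp (- (t * real_exponent \<nu> (\<theta> *\<^sub>R e))) *
    cos (t * Im (levy_exponent b (\<lambda>_. 0) \<nu> (\<theta> *\<^sub>R e)))"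
proof -
  interpret levy_process M X by fact
  have \<nu>: "levy_measure \<nu>" using assms(2) by (simp add: has_levy_triplet_def)
  have [measurable]: "random_variable borel (X t)" using assms(3) by (rule measurable_process)
  let ?\<xi> = "\<theta> *\<^sub>R e"
  have int: "integrable M (\<lambda>\<omega>. exp (\<i> * complex_of_real (?\<xi> \<bullet> X t \<omega>)))"
    by (intro integrable_const_bound[of _ 1]) auto
  have "(\<integral>\<omega>. cos (\<theta> * (X t \<omega> \<bullet> e)) \<partial>M) = (\<integral>\<omega>. Re (exp (\<i> * complex_of_real (?\<xi> \<bullet> X t \<omega>))) \<partial>M)"
    by (intro Bochner_Integration.integral_cong) (auto simp: Re_exp inner_commute)
  also have "\<dots> = Re (\<integral>\<omega>. exp (\<i> * complex_of_real (?\<xi> \<bullet> X t \<omega>)) \<partial>M)"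
    using int by simp
  also have "\<dots> = Re (exp (- complex_of_real t * levy_exponent b (\<lambda>_. 0) \<nu> ?\<xi>))"
  proof -
    have "\<forall>t\<ge>0. \<forall>\<xi>. (\<integral>\<omega>. exp (\<i> * complex_of_real (\<xi> \<bullet> X t \<omega>)) \<partial>M) =
        exp (- complex_of_real t * levy_exponent b (\<lambda>_. 0) \<nu> \<xi>)"
      using assms(2) unfolding has_levy_triplet_def by (elim conjE)
    from this[rule_format, OF assms(3), of ?\<xi>] show ?thesis by (rule arg_cong)
  qed
  also have "\<dots> = exp (- (t * real_exponent \<nu> ?\<xi>)) * cos (t * Im (levy_exponent b (\<lambda>_. 0) \<nu> ?\<xi>))"
    by (simp add: Re_exp Re_levy_exponent[OF \<nu>])
  finally have "(\<integral>\<omega>. cos (\<theta> * (X t \<omega> \<bullet> e)) \<partial>M) = \<dots>" .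
  moreover have "integrable M (\<lambda>\<omega>. cos (\<theta> * (X t \<omega> \<bullet> e)))"
    by (intro integrable_const_bound[of _ 1]) auto
  ultimately show ?thesis by (simp add: prob_space)
qed

lemma limsup_ratio_eq_0I:
  assumes "((\<lambda>t. norm (x t) / t powr \<kappa>) \<longlongrightarrow> 0) (at_right 0)"
  shows "limsup_ratio x \<kappa> = 0"
proof -
  have "((\<lambda>t. ereal (norm (x t) / t powr \<kappa>)) \<longlongrightarrow> ereal 0) (at_right 0)"
    using assms by simp
  then show ?thesis
    unfolding limsup_ratio_def by (simp add: lim_imp_Limsup zero_ereal_def)
qed

lemma limsup_ratio_eq_infinityI:
  assumes "\<And>c \<delta>. 0 < c \<Longrightarrow> 0 < \<delta> \<Longrightarrow> \<exists>t\<in>{0<..\<delta>}. c * t powr \<kappa> \<le> norm (x t)"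
  shows "limsup_ratio x \<kappa> = \<infinity>"
proof (rule ccontr)
  assume "limsup_ratio x \<kappa> \<noteq> \<infinity>"
  then obtain c where "limsup_ratio x \<kappa> < ereal c"
    using ereal_dense2[of "limsup_ratio x \<kappa>" \<infinity>] by (auto simp: less_top[symmetric] top_ereal_def)
  \<comment> \<open>Raising the level to at least \<open>1\<close> makes it positive, as the
    hypothesis on \<open>x\<close> demands.\<close>
  then have c: "limsup_ratio x \<kappa> < ereal (max c 1)"
    by (rule less_le_trans) simp
  then have "\<forall>\<^sub>F t in at_right 0. ereal (norm (x t) / t powr \<kappa>) < ereal (max c 1)"
    unfolding limsup_ratio_def by (rule Limsup_lessD)
  then obtain d where d: "0 < d" "\<And>t. 0 < t \<Longrightarrow> t < d \<Longrightarrow> norm (x t) / t powr \<kappa> < max c 1"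
    by (auto simp: eventually_at_right_field simp flip: ereal_max)
  obtain t where t: "0 < t" "t \<le> d / 2" "max c 1 * t powr \<kappa> \<le> norm (x t)"
    using assms[of "max c 1" "d / 2"] d(1) by (auto simp: less_max_iff_disj)
  then show False using d(2)[of t] by (simp add: field_simps)
qed

text \<open>The sector condition enters here: it bounds the expectation of
  \<open>1 - cos (\<theta> * (X s \<bullet> e))\<close> by \<open>(1 + C) * s\<close> times the real
  part of the exponent. The upper bound is then applied to each coordinate, and the norm is at most
  the sum of the coordinates in absolute value.\<close>

lemma AE_tendsto_zero_at_right:
  assumes "levy_process M X" "has_levy_triplet M X b (\<lambda>_. 0) \<nu>"
    and "sector_condition (levy_exponent b (\<lambda>_. 0) \<nu>)" and "0 < \<kappa>"
    and summable: "\<And>c. 0 < c \<Longrightarrow> summable (\<lambda>n. (2 powr -(1/\<kappa>))^n * truncated_moment \<nu> (c * 2^n))"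
  shows "AE \<omega> in M. ((\<lambda>t. norm (X t \<omega>) / t powr \<kappa>) \<longlongrightarrow> 0) (at_right 0)"
proof -
  have \<nu>: "levy_measure \<nu>" using assms(2) by (simp add: has_levy_triplet_def)
  obtain C where C: "0 < C" "\<And>\<xi>. \<bar>Im (levy_exponent b (\<lambda>_. 0) \<nu> \<xi>)\<bar> \<le> C * real_exponent \<nu> \<xi>"
    using assms(3) by (auto simp: sector_condition_def Re_levy_exponent[OF \<nu>])
  have coord: "AE \<omega> in M. ((\<lambda>t. norm (X t \<omega> \<bullet> e) / t powr \<kappa>) \<longlongrightarrow> 0) (at_right 0)" if e: "e \<in> Basis" for e
  proof (rule levy_process.tendsto_zero_at_right[OF levy_process_inner[OF assms(1)] \<open>0 < \<kappa>\<close>])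
    interpret levy_process M "\<lambda>t \<omega>. X t \<omega> \<bullet> e" by (rule levy_process_inner[OF assms(1)])
    \<comment> \<open>One factor \<open>2\<close> comes from \<open>prob_ge_le_char\<close>, the
      other from \<open>real_exponent_le\<close>, and \<open>1 + C\<close> from the sector
      condition.\<close>
    let ?H = "\<lambda>u. 4 * (1 + C) * truncated_moment \<nu> u"
    fix c :: real assume c: "0 < c"
    show "summable (\<lambda>n. (2 powr -(1/\<kappa>))^n * ?H (c * 2^n))"
      using summable_mult[OF summable[OF c], of "4 * (1 + C)"] by (simp add: mult_ac)
    fix n and s :: real assume s: "0 \<le> s" "s \<le> (2 powr -(1/\<kappa>))^n"
    let ?T = "truncated_moment \<nu> (c * 2^n)"
    have "prob {\<omega> \<in> space M. 2 / (c * 2^n) \<le> \<bar>X s \<omega> \<bullet> e\<bar>} \<le> 2 * (s * (2 * (1 + C) * ?T))"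
    proof (rule prob_ge_le_char)
      show "random_variable borel (\<lambda>\<omega>. X s \<omega> \<bullet> e)" using s(1) by (rule measurable_process)
      show "0 < c * 2^n" using c by simp
      fix \<theta> :: real assume \<theta>: "0 \<le> \<theta>" "\<theta> \<le> c * 2^n"
      let ?r = "real_exponent \<nu> (\<theta> *\<^sub>R e)"
      have "expectation (\<lambda>\<omega>. 1 - cos (\<theta> * (X s \<omega> \<bullet> e)))
          \<le> s * ?r + \<bar>s * Im (levy_exponent b (\<lambda>_. 0) \<nu> (\<theta> *\<^sub>R e))\<bar>"
        unfolding expectation_one_minus_cos[OF assms(1,2) s(1)]
        using s(1) by (intro one_minus_exp_cos_le) (simp add: real_exponent_nonneg)
      also have "\<dots> \<le> s * ?r + s * (C * ?r)"
        using s(1) C(2) by (simp add: abs_mult mult_left_mono)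
      also have "\<dots> = s * ((1 + C) * ?r)" by (simp add: algebra_simps)
      also have "\<dots> \<le> s * ((1 + C) * (2 * ?T))"
        using s(1) C(1) \<theta> e by (intro mult_left_mono real_exponent_le[OF \<nu>]) auto
      finally show "expectation (\<lambda>\<omega>. 1 - cos (\<theta> * (X s \<omega> \<bullet> e))) \<le> s * (2 * (1 + C) * ?T)"
        by (simp add: algebra_simps)
    qed
    also have "\<dots> = s * ?H (c * 2^n)" by simp
    also have "\<dots> \<le> (2 powr -(1/\<kappa>))^n * ?H (c * 2^n)"
      using s C(1) truncated_moment_nonneg[OF \<nu>] by (intro mult_right_mono) auto
    finally show "prob {\<omega> \<in> space M. 2 / (c * 2^n) \<le> norm (X s \<omega> \<bullet> e)} \<le> (2 powr -(1/\<kappa>))^n * ?H (c * 2^n)"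
      by simp
  qed
  have "AE \<omega> in M. \<forall>e\<in>Basis. ((\<lambda>t. norm (X t \<omega> \<bullet> e) / t powr \<kappa>) \<longlongrightarrow> 0) (at_right 0)"
    by (intro AE_finite_allI coord) auto
  then show ?thesis
  proof eventually_elim
    case (elim \<omega>)
    have lim: "((\<lambda>t. \<Sum>e\<in>Basis. norm (X t \<omega> \<bullet> e) / t powr \<kappa>) \<longlongrightarrow> 0) (at_right 0)"
      using elim by (intro tendsto_null_sum) auto
    have "norm (norm (X t \<omega>) / t powr \<kappa>) \<le> (\<Sum>e\<in>Basis. norm (X t \<omega> \<bullet> e) / t powr \<kappa>)" for t
      using norm_le_l1[of "X t \<omega>"] by (simp add: divide_right_mono flip: sum_divide_distrib)
    then show ?case
      by (intro Lim_null_comparison[OF _ lim] always_eventually allI)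
  qed
qed

text \<open>Since the norm is controlled by the largest coordinate, some basis direction
  \<open>e\<close> already has an infinite \<open>\<alpha>\<close>-moment of small jumps. Along
  \<open>e\<close> the weighted sum of the real exponent at the frequencies \<open>2^n\<close>
  diverges, which makes the one-dimensional lower bound applicable.\<close>

lemma AE_limsup_ratio_eq_infinity:
  fixes X :: "real \<Rightarrow> 'w \<Rightarrow> 'a::euclidean_space"
  assumes "levy_process M X" "has_levy_triplet M X b (\<lambda>_. 0) \<nu>"
    and "0 < \<alpha>" "\<alpha> < 2" and inf: "small_jump_moment \<nu> \<alpha> = \<infinity>"
  shows "AE \<omega> in M. limsup_ratio (\<lambda>t. X t \<omega>) (1/\<alpha>) = \<infinity>"
proof -
  have \<nu>: "levy_measure \<nu>" using assms(2) by (simp add: has_levy_triplet_def)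
  have sets_\<nu> [measurable_cong]: "sets \<nu> = sets borel" by (rule sets_levy_measure[OF \<nu>])
  define q where "q = 2 powr -\<alpha>"
  have "0 < q" by (simp add: q_def)
  have max_coord: "\<exists>e\<in>Basis. norm y \<le> DIM('a) * \<bar>y \<bullet> e\<bar>" for y :: 'a
  proof (rule ccontr)
    assume "\<not> ?thesis"
    then have "(\<Sum>e\<in>Basis. DIM('a) * \<bar>y \<bullet> e\<bar>) < (\<Sum>e\<in>(Basis :: 'a set). norm y)"
      by (intro sum_strict_mono) (auto simp: not_le)
    then have "(\<Sum>e\<in>Basis. \<bar>y \<bullet> e\<bar>) < norm y"
      by (simp flip: sum_distrib_left)
    then show False using norm_le_l1[of y] by simp
  qed
  have meas: "(\<lambda>y. ennreal (\<bar>y \<bullet> e\<bar> powr \<alpha>) * indicator {y. norm y < 1} y) \<in> borel_measurable \<nu>" for e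
    unfolding measurable_cong_sets[OF sets_\<nu> refl] by measurable
  have "\<exists>e\<in>Basis. (\<integral>\<^sup>+y\<in>{y. norm y < 1}. ennreal (\<bar>y \<bullet> e\<bar> powr \<alpha>) \<partial>\<nu>) = \<infinity>"
  proof (rule ccontr)
    assume "\<not> ?thesis"
    then have fin: "(\<integral>\<^sup>+y\<in>{y. norm y < 1}. ennreal (\<bar>y \<bullet> e\<bar> powr \<alpha>) \<partial>\<nu>) < \<infinity>" if "e \<in> Basis" for e
      using that by (auto simp: less_top[symmetric])
    have "small_jump_moment \<nu> \<alpha> \<le> (\<integral>\<^sup>+y. ennreal (DIM('a) powr \<alpha>) * (\<Sum>e\<in>Basis. ennreal (\<bar>y \<bullet> e\<bar> powr \<alpha>) * indicator {y. norm y < 1} y) \<partial>\<nu>)"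
      unfolding small_jump_moment_def
    proof (intro nn_integral_mono)
      fix y :: 'a
      obtain e where e: "e \<in> Basis" "norm y \<le> DIM('a) * \<bar>y \<bullet> e\<bar>" using max_coord by blast
      have "norm y powr \<alpha> \<le> (DIM('a) * \<bar>y \<bullet> e\<bar>) powr \<alpha>" using e(2) assms(3) by (intro powr_mono2) auto
      also have "\<dots> = DIM('a) powr \<alpha> * \<bar>y \<bullet> e\<bar> powr \<alpha>" by (simp add: powr_mult)
      finally have "ennreal (norm y powr \<alpha>) \<le> ennreal (DIM('a) powr \<alpha>) * ennreal (\<bar>y \<bullet> e\<bar> powr \<alpha>)"
        by (simp flip: ennreal_mult)
      then have "ennreal (norm y powr \<alpha>) * indicator {y. norm y < 1} y
          \<le> ennreal (DIM('a) powr \<alpha>) * (ennreal (\<bar>y \<bullet> e\<bar> powr \<alpha>) * indicator {y. norm y < 1} y)"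
        by (simp add: indicator_def)
      also have "\<dots> \<le> ennreal (DIM('a) powr \<alpha>) * (\<Sum>e\<in>Basis. ennreal (\<bar>y \<bullet> e\<bar> powr \<alpha>) * indicator {y. norm y < 1} y)"
        using e(1) by (intro mult_left_mono member_le_sum) auto
      finally show "ennreal (norm y powr \<alpha>) * indicator {y. norm y < 1} y \<le> \<dots>" .
    qed
    also have "\<dots> = ennreal (DIM('a) powr \<alpha>) * (\<Sum>e\<in>Basis. \<integral>\<^sup>+y\<in>{y. norm y < 1}. ennreal (\<bar>y \<bullet> e\<bar> powr \<alpha>) \<partial>\<nu>)"
    proof -
      have "(\<integral>\<^sup>+y. (\<Sum>e\<in>Basis. ennreal (\<bar>y \<bullet> e\<bar> powr \<alpha>) * indicator {y. norm y < 1} y) \<partial>\<nu>)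
          = (\<Sum>e\<in>Basis. \<integral>\<^sup>+y\<in>{y. norm y < 1}. ennreal (\<bar>y \<bullet> e\<bar> powr \<alpha>) \<partial>\<nu>)"
        by (intro nn_integral_sum meas)
      moreover have "(\<integral>\<^sup>+y. ennreal (DIM('a) powr \<alpha>) * (\<Sum>e\<in>Basis. ennreal (\<bar>y \<bullet> e\<bar> powr \<alpha>) * indicator {y. norm y < 1} y) \<partial>\<nu>)
          = ennreal (DIM('a) powr \<alpha>) * (\<integral>\<^sup>+y. (\<Sum>e\<in>Basis. ennreal (\<bar>y \<bullet> e\<bar> powr \<alpha>) * indicator {y. norm y < 1} y) \<partial>\<nu>)"
        by (intro nn_integral_cmult borel_measurable_sum meas)
      ultimately show ?thesis by (simp only:)
    qed
    also have "\<dots> < \<infinity>"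
      using fin by (auto simp: ennreal_mult_less_top)
    finally show False using inf by simp
  qed
  then obtain e where e: "e \<in> Basis" "(\<integral>\<^sup>+y\<in>{y. norm y < 1}. ennreal (\<bar>y \<bullet> e\<bar> powr \<alpha>) \<partial>\<nu>) = \<infinity>" ..
  define R where "R \<theta> = real_exponent \<nu> (\<theta> *\<^sub>R e)" for \<theta>
  have pointwise: "ennreal (1/16) * (ennreal (\<bar>y \<bullet> e\<bar> powr \<alpha>) * indicator {y. norm y < 1} y)
      \<le> (\<Sum>n. ennreal (q^n * (1 - cos (2^n * (y \<bullet> e)))))" for y
  proof (cases "y \<bullet> e = 0 \<or> 1 \<le> norm y")
    case False
    define z where "z = \<bar>y \<bullet> e\<bar>"
    have z: "0 < z" "z \<le> (1/2)^0"
      using False Basis_le_norm[OF e(1), of y] by (auto simp: z_def)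
    \<comment> \<open>A single term of the series is enough: the one whose frequency brings
      \<open>2^n * z\<close> into \<open>[1/2, 1]\<close>. There \<open>1 - cos\<close> is at least
      \<open>(1/2)\<^sup>2 / 4 = 1/16\<close>, while \<open>q^n\<close> is at least
      \<open>z powr \<alpha>\<close>.\<close>
    obtain n where n: "(1/2)^(Suc n) < z" "z \<le> (1/2)^n"
      using at_right_0_geometric[of "1/2" z 0] z by auto
    have n': "1/2 \<le> \<bar>2^n * (y \<bullet> e)\<bar>" "\<bar>2^n * (y \<bullet> e)\<bar> \<le> 1"
      using n by (auto simp: z_def abs_mult field_simps power_one_over)
    have "z powr \<alpha> \<le> ((1/2)^n) powr \<alpha>" using n z assms(3) by (intro powr_mono2) auto
    also have "(1/2)^n = 2 powr - real n"
      by (simp add: powr_minus powr_realpow power_one_over inverse_eq_divide)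
    also have "(2 powr - real n) powr \<alpha> = q^n"
      by (simp add: q_def powr_powr powr_power mult.commute)
    finally have "z powr \<alpha> \<le> q^n" .
    moreover have "(1/2)\<^sup>2 \<le> (2^n * (y \<bullet> e))\<^sup>2"
      using n' power_mono[of "1/2" "\<bar>2^n * (y \<bullet> e)\<bar>" 2] by simp
    then have "1/16 \<le> 1 - cos (2^n * (y \<bullet> e))"
      using one_minus_cos_ge[OF n'(2)] by (simp add: power2_eq_square)
    ultimately have "1/16 * z powr \<alpha> \<le> q^n * (1 - cos (2^n * (y \<bullet> e)))"
      using mult_mono[of "z powr \<alpha>" "q^n" "1/16" "1 - cos (2^n * (y \<bullet> e))"] \<open>0 < q\<close> by (simp add: mult.commute)
    then have "ennreal (1/16) * ennreal (z powr \<alpha>) \<le> ennreal (q^n * (1 - cos (2^n * (y \<bullet> e))))"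
      by (subst ennreal_mult[symmetric]) (auto intro: ennreal_leI)
    also have "\<dots> \<le> (\<Sum>n. ennreal (q^n * (1 - cos (2^n * (y \<bullet> e)))))"
      using sum_le_suminf[of "\<lambda>n. ennreal (q^n * (1 - cos (2^n * (y \<bullet> e))))" "{n}"] by simp
    finally show ?thesis using False by (simp add: z_def)
  qed auto
  have R_sum: "(\<Sum>n. ennreal (q^n * R (2^n))) = \<infinity>"
  proof -
    have "\<infinity> = ennreal (1/16) * (\<integral>\<^sup>+y\<in>{y. norm y < 1}. ennreal (\<bar>y \<bullet> e\<bar> powr \<alpha>) \<partial>\<nu>)"
      unfolding e(2) by (simp add: ennreal_mult_top)
    also have "\<dots> = (\<integral>\<^sup>+y. ennreal (1/16) * (ennreal (\<bar>y \<bullet> e\<bar> powr \<alpha>) * indicator {y. norm y < 1} y) \<partial>\<nu>)"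
      by (intro nn_integral_cmult[symmetric] meas)
    also have "\<dots> \<le> (\<integral>\<^sup>+y. (\<Sum>n. ennreal (q^n * (1 - cos (2^n * (y \<bullet> e))))) \<partial>\<nu>)"
      by (intro nn_integral_mono pointwise)
    also have "\<dots> = (\<Sum>n. \<integral>\<^sup>+y. ennreal (q^n * (1 - cos (2^n * (y \<bullet> e)))) \<partial>\<nu>)"
      by (intro nn_integral_suminf) (unfold measurable_cong_sets[OF sets_\<nu> refl], measurable)
    also have "\<dots> = (\<Sum>n. ennreal (q^n * R (2^n)))"
    proof (intro suminf_cong)
      fix n
      have "integrable \<nu> (\<lambda>y. q^n * (1 - cos (2^n * (y \<bullet> e))))"
        using integrable_one_minus_cos[OF \<nu>, of "2^n *\<^sub>R e"] by (intro integrable_mult_right) simp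
      then have "(\<integral>\<^sup>+y. ennreal (q^n * (1 - cos (2^n * (y \<bullet> e)))) \<partial>\<nu>) = ennreal (\<integral>y. q^n * (1 - cos (2^n * (y \<bullet> e))) \<partial>\<nu>)"
        using \<open>0 < q\<close> by (intro nn_integral_eq_integral) auto
      also have "(\<integral>y. q^n * (1 - cos (2^n * (y \<bullet> e))) \<partial>\<nu>) = q^n * R (2^n)"
        unfolding R_def real_exponent_def by (subst integral_mult_right_zero) simp
      finally show "(\<integral>\<^sup>+y. ennreal (q^n * (1 - cos (2^n * (y \<bullet> e)))) \<partial>\<nu>) = ennreal (q^n * R (2^n))" .
    qed
    finally show ?thesis by (simp add: top_unique)
  qed
  have not_summable: "\<not> summable (\<lambda>n. (2 powr -\<alpha>)^n * R (2^n))"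
  proof
    assume "summable (\<lambda>n. (2 powr -\<alpha>)^n * R (2^n))"
    then have "(\<Sum>n. ennreal (q^n * R (2^n))) = ennreal (\<Sum>n. q^n * R (2^n))"
      using \<open>0 < q\<close> by (intro suminf_ennreal2) (auto simp: q_def R_def real_exponent_nonneg)
    then show False using R_sum by simp
  qed
  have lim: "((\<lambda>s. (\<integral>\<omega>. 1 - cos (\<theta> * (X s \<omega> \<bullet> e)) \<partial>M) / s) \<longlongrightarrow> R \<theta>) (at_right 0)" for \<theta>
  proof -
    define I where "I = Im (levy_exponent b (\<lambda>_. 0) \<nu> (\<theta> *\<^sub>R e))"
    \<comment> \<open>The limit is a derivative at zero. The imaginary part \<open>I\<close> enters
      only through \<open>cos (s * I)\<close>, whose derivative vanishes there.\<close>
    have "((\<lambda>s. 1 - exp (- (s * R \<theta>)) * cos (s * I)) has_field_derivative R \<theta>) (at_right 0)"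
      by (auto intro!: derivative_eq_intros)
    then have *: "((\<lambda>s. (1 - exp (- (s * R \<theta>)) * cos (s * I)) / s) \<longlongrightarrow> R \<theta>) (at_right 0)"
      by (simp add: has_field_derivative_iff)
    have "\<forall>\<^sub>F s in at_right (0::real). 0 < s" by (rule eventually_at_right_less)
    then have "\<forall>\<^sub>F s in at_right 0. (1 - exp (- (s * R \<theta>)) * cos (s * I)) / s = (\<integral>\<omega>. 1 - cos (\<theta> * (X s \<omega> \<bullet> e)) \<partial>M) / s"
      by eventually_elim (simp add: expectation_one_minus_cos[OF assms(1,2)] R_def I_def)
    with * show ?thesis by (rule Lim_transform_eventually)
  qed
  have "AE \<omega> in M. \<exists>u\<in>{0<..\<delta>}. c * u powr (1/\<alpha>) \<le> \<bar>X u \<omega> \<bullet> e\<bar>" if "0 < c" "0 < \<delta>" for c \<delta>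
    by (rule AE_exists_large_value[OF levy_process_inner[OF assms(1)] assms(3,4) that lim _ _ not_summable])
       (auto simp: R_def real_exponent_nonneg real_exponent_div_square_tendsto_0[OF \<nu>])
  then have "AE \<omega> in M. \<forall>m k :: nat. \<exists>u\<in>{0<..1 / real (Suc k)}. real (Suc m) * u powr (1/\<alpha>) \<le> \<bar>X u \<omega> \<bullet> e\<bar>"
    by (intro AE_all_countable[THEN iffD2] allI) auto
  then show ?thesis
  proof eventually_elim
    case (elim \<omega>)
    show ?case
    proof (rule limsup_ratio_eq_infinityI)
      fix c \<delta> :: real assume "0 < c" "0 < \<delta>"
      obtain k where k: "1 / real (Suc k) < \<delta>" using \<open>0 < \<delta>\<close> nat_approx_posE by blast
      obtain m where m: "c < real m" using reals_Archimedean2 by blast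
      obtain u where u: "0 < u" "u \<le> 1 / real (Suc k)" "real (Suc m) * u powr (1/\<alpha>) \<le> \<bar>X u \<omega> \<bullet> e\<bar>"
        using elim[rule_format, of k m] by auto
      have "c * u powr (1/\<alpha>) \<le> real (Suc m) * u powr (1/\<alpha>)" using m by (intro mult_right_mono) auto
      also have "\<dots> \<le> \<bar>X u \<omega> \<bullet> e\<bar>" by (rule u(3))
      also have "\<dots> \<le> norm (X u \<omega>)" using e(1) by (rule Basis_le_norm)
      finally show "\<exists>t\<in>{0<..\<delta>}. c * t powr (1/\<alpha>) \<le> norm (X t \<omega>)"
        using u k by (intro bexI[of _ u]) auto
    qed
  qed
qed

section \<open>Summability of truncated moments\<close>

text \<open>After exchanging sum and integral, \<open>sum_powers_min_square_le\<close> at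
  \<open>z = c * norm y\<close> reduces the series to the integral of
  \<open>min 1 ((c * norm y) powr \<alpha>)\<close>. Jumps with \<open>norm y < 1\<close> are
  covered by the assumed moment, the others by \<open>min 1 ((norm y)\<^sup>2)\<close>.\<close>

lemma summable_truncated_moment:
  assumes \<nu>: "levy_measure \<nu>" and "0 < \<alpha>" "\<alpha> < 2" and fin: "small_jump_moment \<nu> \<alpha> < \<infinity>" and "0 < c"
  shows "summable (\<lambda>n. (2 powr -\<alpha>)^n * truncated_moment \<nu> (c * 2^n))"
proof (rule summable_suminf_not_top)
  note sets = measurable_cong_sets[OF sets_levy_measure[OF \<nu>] refl]
  define q where "q = 2 powr -\<alpha>"
  have "0 < q" by (simp add: q_def)
  show "0 \<le> (2 powr -\<alpha>)^n * truncated_moment \<nu> (c * 2^n)" for n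
    by (simp add: truncated_moment_nonneg[OF \<nu>])
  obtain C where C: "0 < C"
    "\<And>N z. 0 \<le> z \<Longrightarrow> (\<Sum>n<N. q^n * min 1 ((2^n * z)\<^sup>2)) \<le> C * min 1 (z powr \<alpha>)"
    unfolding q_def by (rule sum_powers_min_square_le[OF assms(2,3)]) blast
  have pointwise: "(\<Sum>n. ennreal (q^n * min 1 ((c * 2^n * norm y)\<^sup>2)))
      \<le> ennreal C * (ennreal (c powr \<alpha>) * (ennreal (norm y powr \<alpha>) * indicator {y. norm y < 1} y) + ennreal (min 1 ((norm y)\<^sup>2)))" for y
  proof (rule suminf_le_const)
    fix N
    have "(\<Sum>n<N. ennreal (q^n * min 1 ((c * 2^n * norm y)\<^sup>2))) = ennreal (\<Sum>n<N. q^n * min 1 ((2^n * (c * norm y))\<^sup>2))"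
      using \<open>0 < q\<close> by (subst sum_ennreal) (auto simp: mult_ac)
    also have "\<dots> \<le> ennreal (C * min 1 ((c * norm y) powr \<alpha>))"
      using C(2) \<open>0 < c\<close> by (intro ennreal_leI) auto
    also have "\<dots> \<le> ennreal (C * (c powr \<alpha> * (norm y powr \<alpha> * indicator {y. norm y < 1} y) + min 1 ((norm y)\<^sup>2)))"
    proof (intro ennreal_leI mult_left_mono)
      show "min 1 ((c * norm y) powr \<alpha>) \<le> c powr \<alpha> * (norm y powr \<alpha> * indicator {y. norm y < 1} y) + min 1 ((norm y)\<^sup>2)"
      proof (cases "norm y < 1")
        case True
        have "min 1 ((c * norm y) powr \<alpha>) \<le> c powr \<alpha> * norm y powr \<alpha>"
          using \<open>0 < c\<close> by (simp add: powr_mult)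
        then show ?thesis using True by (simp add: add_increasing2)
      next
        case False
        then have "1 \<le> (norm y)\<^sup>2" by (simp add: one_le_power)
        then show ?thesis using False by (simp add: min_absorb1)
      qed
    qed (use C in simp)
    also have "\<dots> = ennreal C * (ennreal (c powr \<alpha>) * (ennreal (norm y powr \<alpha>) * indicator {y. norm y < 1} y) + ennreal (min 1 ((norm y)\<^sup>2)))"
      using C(1) by (simp add: ennreal_mult ennreal_plus ennreal_indicator)
    finally show "(\<Sum>n<N. ennreal (q^n * min 1 ((c * 2^n * norm y)\<^sup>2))) \<le> \<dots>" .
  qed simp
  have "(\<Sum>n. ennreal (q^n * truncated_moment \<nu> (c * 2^n)))
      = (\<Sum>n. \<integral>\<^sup>+y. ennreal (q^n * min 1 ((c * 2^n * norm y)\<^sup>2)) \<partial>\<nu>)"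
  proof (rule suminf_cong)
    fix n
    have "ennreal (q^n * truncated_moment \<nu> (c * 2^n)) = ennreal (q^n) * (\<integral>\<^sup>+y. ennreal (min 1 ((c * 2^n * norm y)\<^sup>2)) \<partial>\<nu>)"
      using \<open>0 < q\<close> by (simp add: ennreal_mult truncated_moment_nonneg[OF \<nu>] ennreal_truncated_moment[OF \<nu>])
    also have "\<dots> = (\<integral>\<^sup>+y. ennreal (q^n) * ennreal (min 1 ((c * 2^n * norm y)\<^sup>2)) \<partial>\<nu>)"
      by (intro nn_integral_cmult[symmetric]) (unfold sets, measurable)
    also have "\<dots> = (\<integral>\<^sup>+y. ennreal (q^n * min 1 ((c * 2^n * norm y)\<^sup>2)) \<partial>\<nu>)"
      using \<open>0 < q\<close> by (intro nn_integral_cong) (simp add: ennreal_mult)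
    finally show "ennreal (q^n * truncated_moment \<nu> (c * 2^n)) = \<dots>" .
  qed
  also have "\<dots> = (\<integral>\<^sup>+y. (\<Sum>n. ennreal (q^n * min 1 ((c * 2^n * norm y)\<^sup>2))) \<partial>\<nu>)"
    by (intro nn_integral_suminf[symmetric]) (unfold sets, measurable)
  also have "\<dots> \<le> (\<integral>\<^sup>+y. ennreal C * (ennreal (c powr \<alpha>) * (ennreal (norm y powr \<alpha>) * indicator {y. norm y < 1} y) + ennreal (min 1 ((norm y)\<^sup>2))) \<partial>\<nu>)"
    by (intro nn_integral_mono pointwise)
  also have "\<dots> = ennreal C * (\<integral>\<^sup>+y. ennreal (c powr \<alpha>) * (ennreal (norm y powr \<alpha>) * indicator {y. norm y < 1} y) + ennreal (min 1 ((norm y)\<^sup>2)) \<partial>\<nu>)"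
    by (intro nn_integral_cmult) (unfold sets, measurable)
  also have "(\<integral>\<^sup>+y. ennreal (c powr \<alpha>) * (ennreal (norm y powr \<alpha>) * indicator {y. norm y < 1} y) + ennreal (min 1 ((norm y)\<^sup>2)) \<partial>\<nu>)
      = (\<integral>\<^sup>+y. ennreal (c powr \<alpha>) * (ennreal (norm y powr \<alpha>) * indicator {y. norm y < 1} y) \<partial>\<nu>) + (\<integral>\<^sup>+y. ennreal (min 1 ((norm y)\<^sup>2)) \<partial>\<nu>)"
    by (intro nn_integral_add) (unfold sets, measurable)
  also have "(\<integral>\<^sup>+y. ennreal (c powr \<alpha>) * (ennreal (norm y powr \<alpha>) * indicator {y. norm y < 1} y) \<partial>\<nu>)
      = ennreal (c powr \<alpha>) * small_jump_moment \<nu> \<alpha>"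
    unfolding small_jump_moment_def by (intro nn_integral_cmult) (unfold sets, measurable)
  also have "ennreal C * (ennreal (c powr \<alpha>) * small_jump_moment \<nu> \<alpha> + (\<integral>\<^sup>+y. ennreal (min 1 ((norm y)\<^sup>2)) \<partial>\<nu>)) < \<infinity>"
    using fin nn_integral_min_square_finite[OF \<nu>] by (simp add: ennreal_mult_less_top)
  finally show "(\<Sum>n. ennreal ((2 powr -\<alpha>)^n * truncated_moment \<nu> (c * 2^n))) \<noteq> top"
    by (simp add: q_def)
qed

text \<open>The truncated moment grows at most like \<open>4^n\<close>, whereas the weight is the
  power of some \<open>q < 1/4\<close>. This serves the case of Blumenthal-Getoor index
  \<open>2\<close>.\<close>

lemma summable_truncated_moment_of_less_half:
  assumes \<nu>: "levy_measure \<nu>" and "0 < \<kappa>" "\<kappa> < 1/2"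
  shows "summable (\<lambda>n. (2 powr -(1/\<kappa>))^n * truncated_moment \<nu> (c * 2^n))"
proof (rule summable_comparison_test)
  define q where "q = 2 powr -(1/\<kappa>)"
  have "2 < 1 / \<kappa>" using assms by (simp add: field_simps)
  then have q: "0 < q" "4 * q < 1"
    using powr_less_mono[of "-(1/\<kappa>)" "-2" 2] by (auto simp: q_def powr_minus)
  let ?T = "truncated_moment \<nu> 1"
  show "summable (\<lambda>n. (4 * q)^n * ((1 + c\<^sup>2) * ?T))"
    using q by (intro summable_mult2 summable_geometric) auto
  have "norm (q^n * truncated_moment \<nu> (c * 2^n)) \<le> (4 * q)^n * ((1 + c\<^sup>2) * ?T)" for n
  proof -
    have "truncated_moment \<nu> (c * 2^n) \<le> (\<integral>y. (1 + (c * 2^n)\<^sup>2) * min 1 ((1 * norm y)\<^sup>2) \<partial>\<nu>)"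
      unfolding truncated_moment_def
      by (intro integral_mono integrable_min_square[OF \<nu>] integrable_mult_right)
         (use min_square_mult_le in auto)
    also have "\<dots> = (1 + (c * 2^n)\<^sup>2) * ?T"
      by (simp add: truncated_moment_def)
    also have "\<dots> \<le> (4^n * (1 + c\<^sup>2)) * ?T"
    proof (intro mult_right_mono truncated_moment_nonneg[OF \<nu>])
      have "(2^n)\<^sup>2 = (4^n :: real)"
        by (simp add: power2_eq_square flip: power_mult_distrib)
      then have eq: "(c * 2^n)\<^sup>2 = 4^n * c\<^sup>2"
        by (simp add: power_mult_distrib)
      show "1 + (c * 2^n)\<^sup>2 \<le> 4^n * (1 + c\<^sup>2)" unfolding eq by (simp add: distrib_left)
    qed
    finally have "q^n * truncated_moment \<nu> (c * 2^n) \<le> q^n * ((4^n * (1 + c\<^sup>2)) * ?T)"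
      using q by (intro mult_left_mono) auto
    then show ?thesis
      using q by (simp add: truncated_moment_nonneg[OF \<nu>] power_mult_distrib mult_ac)
  qed
  then show "\<exists>N. \<forall>n\<ge>N. norm ((2 powr -(1/\<kappa>))^n * truncated_moment \<nu> (c * 2^n)) \<le> (4 * q)^n * ((1 + c\<^sup>2) * ?T)"
    by (auto simp: q_def)
qed

text \<open>At the borderline ratio \<open>1/4\<close> each term with \<open>2^n * z < 1\<close> in
  \<open>sum_powers_min_square_le\<close> would contribute the full \<open>z\<^sup>2\<close>, so no
  bound uniform in \<open>N\<close> could hold. Counting only \<open>2^n * z > 1\<close> leaves a
  geometric tail of order \<open>z\<^sup>2\<close>. The constant \<open>4/3\<close> is the full
  geometric sum, and the induction uses that replacing \<open>z\<close> by \<open>2 * z\<close>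
  multiplies \<open>z\<^sup>2\<close> by \<open>4\<close>.\<close>

lemma sum_quarter_powers_le:
  fixes z :: real
  assumes "0 \<le> z"
  shows "(\<Sum>n<N. (1/4)^n * of_bool (1 < 2^n * z)) \<le> 4/3 * min 1 (z\<^sup>2)"
proof -
  have triv: "(\<Sum>n<N. (1/4)^n * of_bool (1 < 2^n * z)) \<le> (4/3 :: real)" for N and z :: real
  proof -
    have "(\<Sum>n<N. (1/4)^n * of_bool (1 < 2^n * z)) \<le> (\<Sum>n<N. (1/4 :: real)^n)"
      by (intro sum_mono) auto
    also have "\<dots> \<le> (\<Sum>n. (1/4)^n)" by (intro sum_le_suminf summable_geometric) auto
    also have "\<dots> = 4/3" by (subst suminf_geometric) auto
    finally show ?thesis .
  qed
  have "(\<Sum>n<N. (1/4)^n * of_bool (1 < 2^n * z)) \<le> 4/3 * z\<^sup>2" if "0 \<le> z" for z :: real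
    using that
  proof (induction N arbitrary: z)
    case (Suc N)
    show ?case
    proof (cases "1 < z")
      case True
      then have "1 \<le> z\<^sup>2" by (intro one_le_power) auto
      then show ?thesis using triv[of z "Suc N"] by linarith
    next
      case False
      have "(\<Sum>n<Suc N. (1/4)^n * of_bool (1 < 2^n * z)) = (1/4 :: real) * (\<Sum>n<N. (1/4)^n * of_bool (1 < 2^n * (2 * z)))"
        using False by (subst sum.lessThan_Suc_shift) (simp add: sum_distrib_left mult_ac del: sum_mult_of_bool_eq)
      also have "\<dots> \<le> 1/4 * (4/3 * (2 * z)\<^sup>2)" using Suc.prems by (intro mult_left_mono Suc.IH) auto
      finally show ?thesis by (simp add: power_mult_distrib)
    qed
  qed simp
  from this[OF assms] triv[of z N] show ?thesis by (simp add: min_def)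
qed

text \<open>Sum and integral are exchanged and \<open>sum_quarter_powers_le\<close> is used at
  \<open>z = c * norm y\<close>. Finiteness of the tails makes \<open>measure\<close> agree with
  \<open>emeasure\<close> on them.\<close>

lemma summable_tail_measure:
  assumes \<nu>: "levy_measure \<nu>" and "0 < c"
  shows "summable (\<lambda>n. (1/4)^n * measure \<nu> {y. 1 / (c * 2^n) < norm y})"
    and "emeasure \<nu> {y. 1 / c < norm y} < \<infinity>"
proof -
  note sets = measurable_cong_sets[OF sets_levy_measure[OF \<nu>] refl]
  have S: "{y. r < norm y} \<in> sets \<nu>" for r
    unfolding sets_levy_measure[OF \<nu>] by measurable
  have fin: "emeasure \<nu> {y. 1 / c < norm y} < \<infinity>" if "0 < c" for c
  proof -
    have "emeasure \<nu> {y. 1 / c < norm y} = (\<integral>\<^sup>+y. indicator {y. 1 / c < norm y} y \<partial>\<nu>)"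
      using S by simp
    also have "\<dots> \<le> (\<integral>\<^sup>+y. ennreal (min 1 ((c * norm y)\<^sup>2)) \<partial>\<nu>)"
    proof (intro nn_integral_mono)
      fix y :: 'a
      have "1 \<le> (c * norm y)\<^sup>2" if "1 / c < norm y"
        using that \<open>0 < c\<close> by (intro one_le_power) (simp add: field_simps)
      then show "indicator {y. 1 / c < norm y} y \<le> ennreal (min 1 ((c * norm y)\<^sup>2))"
        by (auto simp: indicator_def min_absorb1)
    qed
    also have "\<dots> < \<infinity>" by (simp flip: ennreal_truncated_moment[OF \<nu>])
    finally show ?thesis .
  qed
  then show "emeasure \<nu> {y. 1 / c < norm y} < \<infinity>" using \<open>0 < c\<close> .
  show "summable (\<lambda>n. (1/4)^n * measure \<nu> {y. 1 / (c * 2^n) < norm y})"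
  proof (rule summable_suminf_not_top)
    have "(\<Sum>n. ennreal ((1/4)^n * measure \<nu> {y. 1 / (c * 2^n) < norm y}))
        = (\<Sum>n. \<integral>\<^sup>+y. ennreal ((1/4)^n * of_bool (1 < 2^n * (c * norm y))) \<partial>\<nu>)"
    proof (rule suminf_cong)
      fix n
      have "ennreal ((1/4)^n * measure \<nu> {y. 1 / (c * 2^n) < norm y}) = ennreal ((1/4)^n) * emeasure \<nu> {y. 1 / (c * 2^n) < norm y}"
        using fin[of "c * 2^n"] \<open>0 < c\<close> by (simp add: ennreal_mult emeasure_eq_ennreal_measure less_top)
      also have "\<dots> = (\<integral>\<^sup>+y. ennreal ((1/4)^n) * indicator {y. 1 / (c * 2^n) < norm y} y \<partial>\<nu>)"
        using S by (intro nn_integral_cmult_indicator[symmetric])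
      also have "\<dots> = (\<integral>\<^sup>+y. ennreal ((1/4)^n * of_bool (1 < 2^n * (c * norm y))) \<partial>\<nu>)"
        using \<open>0 < c\<close> by (intro nn_integral_cong) (auto simp: indicator_def field_simps)
      finally show "ennreal ((1/4)^n * measure \<nu> {y. 1 / (c * 2^n) < norm y}) = \<dots>" .
    qed
    also have "\<dots> = (\<integral>\<^sup>+y. (\<Sum>n. ennreal ((1/4)^n * of_bool (1 < 2^n * (c * norm y)))) \<partial>\<nu>)"
      by (intro nn_integral_suminf[symmetric]) (unfold sets, measurable)
    also have "\<dots> \<le> (\<integral>\<^sup>+y. ennreal (4/3 * min 1 ((c * norm y)\<^sup>2)) \<partial>\<nu>)"
    proof (intro nn_integral_mono suminf_le_const)
      fix N and y :: 'a
      have "(\<Sum>n<N. ennreal ((1/4)^n * of_bool (1 < 2^n * (c * norm y)))) = ennreal (\<Sum>n<N. (1/4)^n * of_bool (1 < 2^n * (c * norm y)))"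
        by (rule sum_ennreal) simp
      also have "\<dots> \<le> ennreal (4/3 * min 1 ((c * norm y)\<^sup>2))"
        using \<open>0 < c\<close> by (intro ennreal_leI sum_quarter_powers_le) simp
      finally show "(\<Sum>n<N. ennreal ((1/4)^n * of_bool (1 < 2^n * (c * norm y)))) \<le> \<dots>" .
    qed simp
    also have "\<dots> = ennreal (4/3) * (\<integral>\<^sup>+y. ennreal (min 1 ((c * norm y)\<^sup>2)) \<partial>\<nu>)"
    proof -
      have "(\<integral>\<^sup>+y. ennreal (4/3 * min 1 ((c * norm y)\<^sup>2)) \<partial>\<nu>) = (\<integral>\<^sup>+y. ennreal (4/3) * ennreal (min 1 ((c * norm y)\<^sup>2)) \<partial>\<nu>)"
        by (intro nn_integral_cong ennreal_mult) auto
      then show ?thesis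
        by (simp only:) (intro nn_integral_cmult, unfold sets, measurable)
    qed
    also have "\<dots> < top"
      by (simp add: ennreal_mult_less_top flip: ennreal_truncated_moment[OF \<nu>])
    finally show "(\<Sum>n. ennreal ((1/4)^n * measure \<nu> {y. 1 / (c * 2^n) < norm y})) \<noteq> top" by simp
  qed simp
qed

text \<open>The truncated moment at \<open>1 / r\<close> splits into \<open>1 / r\<^sup>2\<close>
  times the second moment over \<open>norm y \<le> r\<close> and the tail beyond \<open>r\<close>.
  For small \<open>r\<close> the hypothesis bounds the first part by a constant times the tail, so
  the tails, summable with weights \<open>(1/4)^n\<close>, dominate. The exponent
  \<open>1/(1/2)\<close> matches the general criterion at \<open>\<kappa> = 1/2\<close>.\<close>

lemma summable_truncated_moment_of_Limsup:
  assumes \<nu>: "levy_measure \<nu>" and "0 < c"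
    and bounded: "Limsup (at_right 0) (\<lambda>r::real.
         (\<integral>\<^sup>+y\<in>{y. norm y \<le> r}. ennreal ((norm y)\<^sup>2) \<partial>\<nu>) /
         (ennreal (r\<^sup>2) * emeasure \<nu> {y. norm y > r})) < \<infinity>"
  shows "summable (\<lambda>n. (2 powr -(1/(1/2)))^n * truncated_moment \<nu> (c * 2^n))"
proof -
  note sets = measurable_cong_sets[OF sets_levy_measure[OF \<nu>] refl]
  have S: "{y. r < norm y} \<in> sets \<nu>" for r
    unfolding sets_levy_measure[OF \<nu>] by measurable
  define A where "A r = (\<integral>\<^sup>+y\<in>{y. norm y \<le> r}. ennreal ((norm y)\<^sup>2) \<partial>\<nu>)" for r
  obtain K :: nat where "Limsup (at_right 0) (\<lambda>r::real. A r / (ennreal (r\<^sup>2) * emeasure \<nu> {y. r < norm y})) < of_nat K"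
    using ennreal_Ex_less_of_nat bounded unfolding A_def by (auto simp: less_top)
  then have ev: "\<forall>\<^sub>F r in at_right 0. A r / (ennreal (r\<^sup>2) * emeasure \<nu> {y. r < norm y}) < of_nat K"
    by (rule Limsup_lessD)
  have T_le: "truncated_moment \<nu> (1 / r) \<le> (real K + 1) * measure \<nu> {y. r < norm y}"
    if r: "0 < r" "A r / (ennreal (r\<^sup>2) * emeasure \<nu> {y. r < norm y}) < of_nat K" for r
  proof -
    let ?N = "emeasure \<nu> {y. r < norm y}"
    have N: "?N < \<infinity>" using summable_tail_measure(2)[OF \<nu>, of "1 / r"] r by simp
    have A: "A r \<le> of_nat K * (ennreal (r\<^sup>2) * ?N)"
    \<comment> \<open>With zero denominator a positive numerator would make the ratio infinite, so
      finiteness of the ratio forces the numerator to vanish.\<close>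
    proof (cases "ennreal (r\<^sup>2) * ?N = 0")
      case True
      then have "A r = 0" using r(2) by (cases "A r = 0") (auto simp: ennreal_divide_zero)
      then show ?thesis by simp
    next
      case False
      have "A r = A r / (ennreal (r\<^sup>2) * ?N) * (ennreal (r\<^sup>2) * ?N)"
        using False N by (simp add: ennreal_divide_times ennreal_mult_eq_top_iff ennreal_times_divide
            ennreal_mult_less_top less_top)
      also have "\<dots> \<le> of_nat K * (ennreal (r\<^sup>2) * ?N)"
        using r(2) by (intro mult_right_mono) auto
      finally show ?thesis .
    qed
    have "ennreal (truncated_moment \<nu> (1 / r))
        \<le> (\<integral>\<^sup>+y. ennreal (1 / r\<^sup>2) * (ennreal ((norm y)\<^sup>2) * indicator {y. norm y \<le> r} y) + indicator {y. r < norm y} y \<partial>\<nu>)"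
      unfolding ennreal_truncated_moment[OF \<nu>]
    proof (intro nn_integral_mono)
      fix y :: 'a
      show "ennreal (min 1 ((1 / r * norm y)\<^sup>2)) \<le> ennreal (1 / r\<^sup>2) * (ennreal ((norm y)\<^sup>2) * indicator {y. norm y \<le> r} y) + indicator {y. r < norm y} y"
      proof (cases "norm y \<le> r")
        case True
        have "ennreal (min 1 ((1 / r * norm y)\<^sup>2)) \<le> ennreal (1 / r\<^sup>2 * (norm y)\<^sup>2)"
          by (intro ennreal_leI) (simp add: power_divide)
        also have "\<dots> = ennreal (1 / r\<^sup>2) * ennreal ((norm y)\<^sup>2)" by (intro ennreal_mult) auto
        finally show ?thesis using True by simp
      qed simp
    qed
    also have "\<dots> = (\<integral>\<^sup>+y. ennreal (1 / r\<^sup>2) * (ennreal ((norm y)\<^sup>2) * indicator {y. norm y \<le> r} y) \<partial>\<nu>) + (\<integral>\<^sup>+y. indicator {y. r < norm y} y \<partial>\<nu>)"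
      by (intro nn_integral_add) (unfold sets, measurable)
    also have "(\<integral>\<^sup>+y. ennreal (1 / r\<^sup>2) * (ennreal ((norm y)\<^sup>2) * indicator {y. norm y \<le> r} y) \<partial>\<nu>) = ennreal (1 / r\<^sup>2) * A r"
      unfolding A_def by (intro nn_integral_cmult) (unfold sets, measurable)
    also have "(\<integral>\<^sup>+y. indicator {y. r < norm y} y \<partial>\<nu>) = ?N" using S by simp
    also have "ennreal (1 / r\<^sup>2) * A r + ?N \<le> ennreal (1 / r\<^sup>2) * (of_nat K * (ennreal (r\<^sup>2) * ?N)) + ?N"
      by (intro add_right_mono mult_left_mono A) simp
    also have "\<dots> = (ennreal (1 / r\<^sup>2) * ennreal (r\<^sup>2)) * (of_nat K * ?N) + ?N" by (simp only: mult_ac)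
    also have "ennreal (1 / r\<^sup>2) * ennreal (r\<^sup>2) = 1" using r by (simp flip: ennreal_mult)
    also have "1 * (of_nat K * ?N) + ?N = ennreal ((real K + 1) * measure \<nu> {y. r < norm y})"
      using N by (simp add: emeasure_eq_ennreal_measure less_top distrib_right ennreal_plus ennreal_mult ennreal_of_nat_eq_real_of_nat)
    finally show ?thesis by (subst (asm) ennreal_le_iff) auto
  qed
  have "filterlim (\<lambda>n. 1 / (c * 2^n)) (at_right 0) sequentially"
  proof (rule tendsto_imp_filterlim_at_right)
    have "(\<lambda>n. (1 / c) * (1/2)^n) \<longlonglongrightarrow> (1 / c) * 0" by (intro tendsto_intros) auto
    then show "(\<lambda>n. 1 / (c * 2^n)) \<longlonglongrightarrow> 0" by (simp add: power_one_over)
  qed (use \<open>0 < c\<close> in simp)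
  then have ev': "\<forall>\<^sub>F n in sequentially. A (1 / (c * 2^n)) / (ennreal ((1 / (c * 2^n))\<^sup>2) * emeasure \<nu> {y. 1 / (c * 2^n) < norm y}) < of_nat K"
    using ev by (rule filterlim_iff[THEN iffD1, rule_format])
  have q: "2 powr -(1/(1/2)) = (1/4 :: real)" by (simp add: powr_minus)
  show ?thesis
    unfolding q
  proof (rule summable_comparison_test_ev)
    show "summable (\<lambda>n. (real K + 1) * ((1/4)^n * measure \<nu> {y. 1 / (c * 2^n) < norm y}))"
      by (intro summable_mult summable_tail_measure[OF \<nu> \<open>0 < c\<close>])
    show "\<forall>\<^sub>F n in sequentially. norm ((1/4)^n * truncated_moment \<nu> (c * 2^n))
        \<le> (real K + 1) * ((1/4)^n * measure \<nu> {y. 1 / (c * 2^n) < norm y})"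
      using ev'
    proof eventually_elim
      case (elim n)
      have "truncated_moment \<nu> (c * 2^n) \<le> (real K + 1) * measure \<nu> {y. 1 / (c * 2^n) < norm y}"
        using T_le[OF _ elim] \<open>0 < c\<close> by simp
      then have "(1/4)^n * truncated_moment \<nu> (c * 2^n) \<le> (1/4)^n * ((real K + 1) * measure \<nu> {y. 1 / (c * 2^n) < norm y})"
        by (intro mult_left_mono) auto
      then show ?case by (simp add: truncated_moment_nonneg[OF \<nu>] mult_ac)
    qed
  qed
qed

section \<open>Deduction of the three statements from the almost sure criteria\<close>

theorem corollary2p4:
  fixes M :: "'w measure" and X :: "real \<Rightarrow> 'w \<Rightarrow> 'a::euclidean_space"
    and b :: 'a and \<nu> :: "'a measure"
  assumes "levy_process M X"
    and "has_levy_triplet M X b (\<lambda>_. 0) \<nu>"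
    and "sector_condition (levy_exponent b (\<lambda>_. 0) \<nu>)"
  shows
    "(\<forall>\<kappa>>1/2.
        ((AE \<omega> in M. limsup_ratio (\<lambda>t. X t \<omega>) \<kappa> = 0) \<longleftrightarrow> small_jump_moment \<nu> (1/\<kappa>) < \<infinity>) \<and>
        ((AE \<omega> in M. limsup_ratio (\<lambda>t. X t \<omega>) \<kappa> = \<infinity>) \<longleftrightarrow> small_jump_moment \<nu> (1/\<kappa>) = \<infinity>)) \<and>
     (\<forall>\<kappa>>0.
        (ereal \<kappa> < 1 / ereal (blumenthal_getoor_index \<nu>) \<longrightarrow> (AE \<omega> in M. limsup_ratio (\<lambda>t. X t \<omega>) \<kappa> = 0)) \<and>
        (ereal \<kappa> > 1 / ereal (blumenthal_getoor_index \<nu>) \<longrightarrow> (AE \<omega> in M. limsup_ratio (\<lambda>t. X t \<omega>) \<kappa> = \<infinity>))) \<and>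
     (Limsup (at_right 0) (\<lambda>r::real.
         (\<integral>\<^sup>+y\<in>{y. norm y \<le> r}. ennreal ((norm y)\<^sup>2) \<partial>\<nu>) /
         (ennreal (r\<^sup>2) * emeasure \<nu> {y. norm y > r})) < \<infinity> \<longrightarrow>
       (AE \<omega> in M. Limsup (at_right 0) (\<lambda>t. ereal (norm (X t \<omega>) / sqrt t)) = 0))"
proof -
  interpret levy_process M X by fact
  have \<nu>: "levy_measure \<nu>" using assms(2) by (simp add: has_levy_triplet_def)
  define \<beta> where "\<beta> = blumenthal_getoor_index \<nu>"
  have \<beta>: "0 \<le> \<beta>" "\<beta> \<le> 2"
    using blumenthal_getoor_index_bounds[OF \<nu>] by (auto simp: \<beta>_def)
  have zero: "AE \<omega> in M. limsup_ratio (\<lambda>t. X t \<omega>) \<kappa> = 0"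
    if "0 < \<kappa>" "\<And>c. 0 < c \<Longrightarrow> summable (\<lambda>n. (2 powr -(1/\<kappa>))^n * truncated_moment \<nu> (c * 2^n))" for \<kappa>
  proof -
    have "AE \<omega> in M. ((\<lambda>t. norm (X t \<omega>) / t powr \<kappa>) \<longlongrightarrow> 0) (at_right 0)"
      by (rule AE_tendsto_zero_at_right[OF assms that])
    then show ?thesis by eventually_elim (rule limsup_ratio_eq_0I)
  qed
  have zero': "AE \<omega> in M. limsup_ratio (\<lambda>t. X t \<omega>) \<kappa> = 0"
    if "1/2 < \<kappa>" "small_jump_moment \<nu> (1/\<kappa>) < \<infinity>" for \<kappa>
    using that by (intro zero summable_truncated_moment[OF \<nu>]) (auto simp: field_simps)
  have infinity: "AE \<omega> in M. limsup_ratio (\<lambda>t. X t \<omega>) \<kappa> = \<infinity>"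
    if "1/2 < \<kappa>" "small_jump_moment \<nu> (1/\<kappa>) = \<infinity>" for \<kappa>
    using AE_limsup_ratio_eq_infinity[OF assms(1,2) _ _ that(2)] that(1) by (simp add: field_simps)
  \<comment> \<open>The two almost sure conclusions exclude each other on a probability space, so
    each converse in (a) follows from the direct implication for the opposite case.\<close>
  have not_both: False
    if "AE \<omega> in M. limsup_ratio (\<lambda>t. X t \<omega>) \<kappa> = 0" "AE \<omega> in M. limsup_ratio (\<lambda>t. X t \<omega>) \<kappa> = \<infinity>" for \<kappa>
  proof -
    from that have "AE \<omega> in M. False" by eventually_elim simp
    then show False by simp
  qed
  have a: "((AE \<omega> in M. limsup_ratio (\<lambda>t. X t \<omega>) \<kappa> = 0) \<longleftrightarrow> small_jump_moment \<nu> (1/\<kappa>) < \<infinity>) \<and>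
      ((AE \<omega> in M. limsup_ratio (\<lambda>t. X t \<omega>) \<kappa> = \<infinity>) \<longleftrightarrow> small_jump_moment \<nu> (1/\<kappa>) = \<infinity>)"
    if "1/2 < \<kappa>" for \<kappa>
    using zero'[OF that] infinity[OF that] not_both[of \<kappa>]
    by (cases "small_jump_moment \<nu> (1/\<kappa>) = \<infinity>") (auto simp: less_top[symmetric])
  have b1: "AE \<omega> in M. limsup_ratio (\<lambda>t. X t \<omega>) \<kappa> = 0" if "0 < \<kappa>" "ereal \<kappa> < 1 / ereal \<beta>" for \<kappa>
  proof -
    \<comment> \<open>For \<open>\<beta> = 0\<close> the extended quotient is infinite and the claim
      is just positivity of \<open>1 / \<kappa>\<close>.\<close>
    have less: "\<beta> < 1 / \<kappa>"
      using that \<beta> by (cases "\<beta> = 0") (auto simp: field_simps one_ereal_def)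
    show ?thesis
    proof (rule zero[OF \<open>0 < \<kappa>\<close>])
      fix c :: real assume "0 < c"
      show "summable (\<lambda>n. (2 powr -(1/\<kappa>))^n * truncated_moment \<nu> (c * 2^n))"
      \<comment> \<open>If \<open>\<beta> < 2\<close>, there is an exponent \<open>\<alpha>\<close>
        with finite moment below both \<open>2\<close> and \<open>1 / \<kappa>\<close>, and the
        weights for \<open>\<kappa>\<close> are smaller than those for \<open>\<alpha>\<close>. If
        \<open>\<beta> = 2\<close>, the hypothesis forces \<open>\<kappa> < 1/2\<close>.\<close>
      proof (cases "\<beta> < 2")
        case True
        have "\<exists>\<alpha>\<in>{\<alpha>. 0 < \<alpha> \<and> small_jump_moment \<nu> \<alpha> < \<infinity>}. \<alpha> < min 2 (1/\<kappa>)"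
          using True less small_jump_moment_2[OF \<nu>]
          by (intro cInf_lessD) (auto simp: \<beta>_def blumenthal_getoor_index_def intro: exI[of _ 2])
        then obtain \<alpha> where \<alpha>: "0 < \<alpha>" "small_jump_moment \<nu> \<alpha> < \<infinity>" "\<alpha> < 2" "\<alpha> < 1/\<kappa>" by auto
        show ?thesis
        proof (rule summable_comparison_test[OF _ summable_truncated_moment[OF \<nu> \<alpha>(1,3,2) \<open>0 < c\<close>]])
          have "norm ((2 powr -(1/\<kappa>))^n * truncated_moment \<nu> (c * 2^n)) \<le> (2 powr -\<alpha>)^n * truncated_moment \<nu> (c * 2^n)" for n
            using \<alpha>(4) by (auto simp: truncated_moment_nonneg[OF \<nu>] intro!: mult_right_mono power_mono)
          then show "\<exists>N. \<forall>n\<ge>N. norm ((2 powr -(1/\<kappa>))^n * truncated_moment \<nu> (c * 2^n)) \<le> (2 powr -\<alpha>)^n * truncated_moment \<nu> (c * 2^n)"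
            by blast
        qed
      next
        case False
        then have "\<kappa> < 1/2" using less that(1) \<beta> by (simp add: field_simps)
        then show ?thesis using that(1) by (intro summable_truncated_moment_of_less_half[OF \<nu>])
      qed
    qed
  qed
  have b2: "AE \<omega> in M. limsup_ratio (\<lambda>t. X t \<omega>) \<kappa> = \<infinity>" if "0 < \<kappa>" "1 / ereal \<beta> < ereal \<kappa>" for \<kappa>
  proof -
    \<comment> \<open>For \<open>\<beta> = 0\<close> the hypothesis would put a real number above
      infinity. Otherwise \<open>1 / \<kappa> < \<beta> \<le> 2\<close>, so
      \<open>\<kappa> > 1/2\<close> and the criterion of (a) is available, with an infinite moment
      since \<open>1 / \<kappa>\<close> lies below the infimum.\<close>
    have "\<beta> \<noteq> 0" using that by (intro notI) (simp add: divide_ereal_def flip: zero_ereal_def)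
    then have less: "1 / \<kappa> < \<beta>" "0 < \<beta>"
      using that \<beta> by (auto simp: field_simps one_ereal_def)
    then have "1 / \<kappa> < 2" using \<beta> by linarith
    then have "1/2 < \<kappa>" using that(1) by (simp add: field_simps)
    moreover have "small_jump_moment \<nu> (1/\<kappa>) = \<infinity>"
    proof (rule ccontr)
      assume "small_jump_moment \<nu> (1/\<kappa>) \<noteq> \<infinity>"
      then have "\<beta> \<le> 1 / \<kappa>"
        unfolding \<beta>_def blumenthal_getoor_index_def using that(1)
        by (intro cInf_lower) (auto simp: less_top[symmetric] intro!: bdd_belowI[of _ 0])
      then show False using less by simp
    qed
    ultimately show ?thesis by (rule infinity)
  qed
  have c: "AE \<omega> in M. Limsup (at_right 0) (\<lambda>t. ereal (norm (X t \<omega>) / sqrt t)) = 0"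
    if "Limsup (at_right 0) (\<lambda>r::real.
         (\<integral>\<^sup>+y\<in>{y. norm y \<le> r}. ennreal ((norm y)\<^sup>2) \<partial>\<nu>) /
         (ennreal (r\<^sup>2) * emeasure \<nu> {y. norm y > r})) < \<infinity>"
  proof -
    have "AE \<omega> in M. limsup_ratio (\<lambda>t. X t \<omega>) (1/2) = 0"
      by (intro zero summable_truncated_moment_of_Limsup[OF \<nu> _ that]) auto
    moreover have "limsup_ratio x (1/2) = Limsup (at_right 0) (\<lambda>t. ereal (norm (x t) / sqrt t))" for x :: "real \<Rightarrow> 'a"
      unfolding limsup_ratio_def
    proof (rule Limsup_eq)
      have "\<forall>\<^sub>F t in at_right (0::real). 0 < t" by (rule eventually_at_right_less)
      then show "\<forall>\<^sub>F t in at_right 0. ereal (norm (x t) / t powr (1/2)) = ereal (norm (x t) / sqrt t)"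
        by eventually_elim (simp add: powr_half_sqrt)
    qed
    ultimately show ?thesis by simp
  qed
  show ?thesis
    using a b1 b2 c unfolding \<beta>_def by blast
qed

end
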